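(* Let $(M^d,c)$ be a connected Riemannian conformal manifold of dimension $d\geq 3$ and let $\mathcal{K}_c$ be its vector space of parallel standard tractors. Suppose $K_1,K_2\in\mathcal{K}_c$ are linearly independent, with $S_{K_2}<0$ and $\Sigma_{K_2}\neq\emptyset$. Then on $M\setminus\Sigma_{K_1}$ the hypersurface $\Sigma_{K_2}$ (is totally umbilic and) has constant mean curvature with respect to the Einstein metric $g^o:=\sigma_{K_1}^{-2}\mathbf{g}$ determined by $K_1$. If the tractors $K_1$ and $K_2$ are orthogonal, i.e. $h(K_1,K_2)=0$, then $\Sigma_{K_2}$ is minimal (and hence totally geodesic) with respect to the Einstein metric $g^o$.
   Context: All manifolds and structures are smooth. A Riemannian conformal structure $c$ on $M^d$ is an equivalence class of Riemannian metrics under $g\sim e^{2\omega}g$, $\omega\in C^\infty(M)$. For $w\in\mathbb{R}$, $\mathcal{E}[w]$ is the line bundle of conformal densities: a section is a family of functions $(f_g)_{g\in c}$ with $f_{e^{2\omega}g}=e^{w\omega}f_g$; $[w]$ denotes tensoring with $\mathcal{E}[w]$. The conformal metric $\mathbf{g}\in S^2T^*M[2]$ is the tautological section represented by $g$ in the scale $g$; it is used to raise and lower indices. The Schouten tensor $P$ of $g$ is defined by $\mathrm{Ric}=(d-2)P+Jg$, $J=\mathrm{tr}_gP$. The standard tractor bundle $\mathcal{T}$ of $(M,c)$: each $g\in c$ identifies $\mathcal{T}$ with $\mathcal{E}[1]\oplus T^*M[1]\oplus\mathcal{E}[-1]$, so sections are triples $(\sigma,\mu_a,\rho)$; for $\hat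 g=e^{2\omega}g$ and $\Upsilon=d\omega$ the identifications are related by $(\hat\sigma,\hat\mu_b,\hat\rho)=(\sigma,\ \mu_b+\sigma\Upsilon_b,\ \rho-\mathbf{g}^{bc}\Upsilon_b\mu_c-\tfrac12\sigma\mathbf{g}^{bc}\Upsilon_b\Upsilon_c)$. The tractor metric $h$, of signature $(d+1,1)$, is given by $h(U,U)=2\sigma\rho+\mu^a\mu_a$ for $U=(\sigma,\mu_a,\rho)$. The tractor connection, which preserves $h$, is $$\nabla_a(\sigma,\mu^b,\rho)=(\nabla_a\sigma-\mu_a,\ \nabla_a\mu^b+\delta_a{}^b\rho+P_a{}^b\sigma,\ \nabla_a\rho-P_{ac}\mu^c).$$ The canonical tractor $X$ is the section of $\mathcal{T}[1]$ with $h(X,U)=\sigma$. For a non-zero parallel tractor $K$ put $\sigma_K:=h(X,K)$, $S_K:=-h(K,K)$ (a constant), and let $\Sigma_K$ (the scale singularity set) be the zero set of $\sigma_K$. It is known that $M\setminus\Sigma_K$ is open and dense, that $\sigma_K^{-2}\mathbf{g}$ is Einstein there, and that if $S_K<0$ and $\Sigma_K\ne\emptyset$ then $\Sigma_K$ is a smooth totally umbilic hypersurface. *)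

theory Defs
  imports "HOL-Analysis.Analysis"
begin

text \<open>
  A manifold is a Hausdorff, second countable type \<open>'m\<close> with a smooth atlas; its dimension is
  \<open>CARD('n)\<close>.  Tensors are given by their components in the charts of the atlas, subject to the
  classical transformation law.  Components \<open>g C p\<close> with \<open>p\<close> outside the domain of \<open>C\<close>,
  or \<open>C\<close> outside the atlas, are junk and are never constrained or inspected.
\<close>

section \<open>Smooth manifolds\<close>

definition partial :: "'n::finite \<Rightarrow> (real^'n \<Rightarrow> real) \<Rightarrow> real^'n \<Rightarrow> real" where
  "partial a f x = frechet_derivative f (at x) (axis a 1)"

text \<open>Used on open sets only.\<close>

primrec Ck_on :: "nat \<Rightarrow> (real^'n::finite) set \<Rightarrow> (real^'n \<Rightarrow> real) \<Rightarrow> bool" where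
  "Ck_on 0 S f \<longleftrightarrow> continuous_on S f"
| "Ck_on (Suc k) S f \<longleftrightarrow> (\<forall>x\<in>S. f differentiable (at x)) \<and> (\<forall>a. Ck_on k S (partial a f))"

definition smooth_on :: "(real^'n::finite) set \<Rightarrow> (real^'n \<Rightarrow> real) \<Rightarrow> bool" where
  "smooth_on S f \<longleftrightarrow> (\<forall>k. Ck_on k S f)"

type_synonym ('m, 'n) chart = "'m set \<times> ('m \<Rightarrow> real^'n)"

abbreviation chart_dom :: "('m, 'n) chart \<Rightarrow> 'm set" where
  "chart_dom \<equiv> fst"

abbreviation chart_map :: "('m, 'n) chart \<Rightarrow> 'm \<Rightarrow> real^'n" where
  "chart_map \<equiv> snd"

definition chart_inv :: "('m, 'n) chart \<Rightarrow> real^'n \<Rightarrow> 'm" where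
  "chart_inv C = inv_into (chart_dom C) (chart_map C)"

definition is_chart :: "('m::topological_space, 'n::finite) chart \<Rightarrow> bool" where
  "is_chart C \<longleftrightarrow> open (chart_dom C) \<and> open (chart_map C ` chart_dom C) \<and>
     homeomorphism (chart_dom C) (chart_map C ` chart_dom C) (chart_map C) (chart_inv C)"

definition smooth_atlas :: "('m::{t2_space, second_countable_topology}, 'n::finite) chart set \<Rightarrow> bool" where
  "smooth_atlas A \<longleftrightarrow> (\<forall>C\<in>A. is_chart C) \<and> (\<Union>C\<in>A. chart_dom C) = UNIV \<and>
     (\<forall>C\<in>A. \<forall>C'\<in>A. \<forall>i. smooth_on (chart_map C ` (chart_dom C \<inter> chart_dom C'))
        (\<lambda>x. chart_map C' (chart_inv C x) $ i))"

definition smooth_fun :: "('m, 'n::finite) chart set \<Rightarrow> 'm set \<Rightarrow> ('m \<Rightarrow> real) \<Rightarrow> bool" where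
  "smooth_fun A U f \<longleftrightarrow>
     (\<forall>C\<in>A. smooth_on (chart_map C ` (U \<inter> chart_dom C)) (\<lambda>x. f (chart_inv C x)))"

text \<open>\<open>pdv C a f p\<close> is the coordinate derivative of \<open>f\<close> at \<open>p\<close>, \<open>\<partial>f/\<partial>x\<^sup>a\<close>, for the coordinates
  \<open>x\<close> of the chart \<open>C\<close>.\<close>

definition pdv :: "('m, 'n::finite) chart \<Rightarrow> 'n \<Rightarrow> ('m \<Rightarrow> real) \<Rightarrow> 'm \<Rightarrow> real" where
  "pdv C a f p = partial a (\<lambda>x. f (chart_inv C x)) (chart_map C p)"

definition jacobian :: "('m, 'n::finite) chart \<Rightarrow> ('m, 'n) chart \<Rightarrow> 'm \<Rightarrow> real^'n^'n" where
  "jacobian C C' p = (\<chi> i j. pdv C j (\<lambda>q. chart_map C' q $ i) p)"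

type_synonym ('m, 'n) vec_comps = "('m, 'n) chart \<Rightarrow> 'm \<Rightarrow> real^'n"
type_synonym ('m, 'n) metric = "('m, 'n) chart \<Rightarrow> 'm \<Rightarrow> real^'n^'n"

definition smooth_vector_field :: "('m, 'n::finite) chart set \<Rightarrow> 'm set \<Rightarrow> ('m, 'n) vec_comps \<Rightarrow> bool" where
  "smooth_vector_field A U N \<longleftrightarrow>
     (\<forall>C\<in>A. \<forall>a. smooth_on (chart_map C ` (U \<inter> chart_dom C)) (\<lambda>x. N C (chart_inv C x) $ a)) \<and>
     (\<forall>C\<in>A. \<forall>C'\<in>A. \<forall>p \<in> U \<inter> chart_dom C \<inter> chart_dom C'. N C' p = jacobian C C' p *v N C p)"

definition smooth_one_form :: "('m, 'n::finite) chart set \<Rightarrow> 'm set \<Rightarrow> ('m, 'n) vec_comps \<Rightarrow> bool" where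
  "smooth_one_form A U m \<longleftrightarrow>
     (\<forall>C\<in>A. \<forall>a. smooth_on (chart_map C ` (U \<inter> chart_dom C)) (\<lambda>x. m C (chart_inv C x) $ a)) \<and>
     (\<forall>C\<in>A. \<forall>C'\<in>A. \<forall>p \<in> U \<inter> chart_dom C \<inter> chart_dom C'.
        m C p = transpose (jacobian C C' p) *v m C' p)"

definition riemannian_metric :: "('m, 'n::finite) chart set \<Rightarrow> 'm set \<Rightarrow> ('m, 'n) metric \<Rightarrow> bool" where
  "riemannian_metric A U g \<longleftrightarrow>
     (\<forall>C\<in>A. \<forall>a b. smooth_on (chart_map C ` (U \<inter> chart_dom C)) (\<lambda>x. g C (chart_inv C x) $ a $ b)) \<and>
     (\<forall>C\<in>A. \<forall>p \<in> U \<inter> chart_dom C. transpose (g C p) = g C p \<and> (\<forall>v. v \<noteq> 0 \<longrightarrow> v \<bullet> (g C p *v v) > 0)) \<and>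
     (\<forall>C\<in>A. \<forall>C'\<in>A. \<forall>p \<in> U \<inter> chart_dom C \<inter> chart_dom C'.
        g C p = transpose (jacobian C C' p) ** g C' p ** jacobian C C' p)"


section \<open>Levi-Civita connection and curvature\<close>

text \<open>\<open>ginv g C p $ a $ b\<close> is \<open>g\<^sup>a\<^sup>b\<close>; \<open>christoffel g C a b k p\<close> is \<open>\<Gamma>\<^sup>k\<^sub>a\<^sub>b\<close>.\<close>

definition ginv :: "('m, 'n::finite) metric \<Rightarrow> ('m, 'n) metric" where
  "ginv g C p = matrix_inv (g C p)"

definition christoffel :: "('m, 'n::finite) metric \<Rightarrow> ('m, 'n) chart \<Rightarrow> 'n \<Rightarrow> 'n \<Rightarrow> 'n \<Rightarrow> 'm \<Rightarrow> real" where
  "christoffel g C a b k p = (1/2) * (\<Sum>l\<in>UNIV. ginv g C p $ k $ l *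
      (pdv C a (\<lambda>q. g C q $ b $ l) p + pdv C b (\<lambda>q. g C q $ a $ l) p - pdv C l (\<lambda>q. g C q $ a $ b) p))"

text \<open>\<open>nabla_vec g C V a b p\<close> is \<open>\<nabla>\<^sub>a V\<^sup>b\<close>.\<close>

definition nabla_vec :: "('m, 'n::finite) metric \<Rightarrow> ('m, 'n) chart \<Rightarrow> ('m \<Rightarrow> real^'n) \<Rightarrow> 'n \<Rightarrow> 'n \<Rightarrow> 'm \<Rightarrow> real" where
  "nabla_vec g C V a b p = pdv C a (\<lambda>q. V q $ b) p + (\<Sum>k\<in>UNIV. christoffel g C a k b p * V p $ k)"

text \<open>The sign is the one for which round spheres have positive Ricci curvature.\<close>

definition ricci :: "('m, 'n::finite) metric \<Rightarrow> ('m, 'n) chart \<Rightarrow> 'm \<Rightarrow> real^'n^'n" where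
  "ricci g C p = (\<chi> i j. \<Sum>k\<in>UNIV.
      pdv C k (christoffel g C i j k) p - pdv C j (christoffel g C i k k) p
      + (\<Sum>l\<in>UNIV. christoffel g C k l k p * christoffel g C i j l p
                - christoffel g C j l k p * christoffel g C i k l p))"

definition metric_trace :: "('m, 'n::finite) metric \<Rightarrow> ('m, 'n) chart \<Rightarrow> 'm \<Rightarrow> real^'n^'n \<Rightarrow> real" where
  "metric_trace g C p B = (\<Sum>a\<in>UNIV. \<Sum>b\<in>UNIV. ginv g C p $ a $ b * B $ a $ b)"

definition schouten :: "('m, 'n::finite) metric \<Rightarrow> ('m, 'n) chart \<Rightarrow> 'm \<Rightarrow> real^'n^'n" where
  "schouten g C p = (THE P. ricci g C p =
      (real CARD('n) - 2) *\<^sub>R P + metric_trace g C p P *\<^sub>R g C p)"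

text \<open>The description above is proper in dimension at least three.\<close>

lemma metric_trace_metric:
  fixes g :: "('m, 'n::finite) metric"
  assumes "transpose (g C p) = g C p" and pos: "\<And>v. v \<noteq> 0 \<Longrightarrow> v \<bullet> (g C p *v v) > 0"
  shows "metric_trace g C p (g C p) = real CARD('n)"
proof -
  have "invertible (g C p)"
  proof -
    have "x = 0" if "g C p *v x = 0" for x
      using pos[of x] that by force
    then show ?thesis
      by (metis matrix_left_invertible_ker invertible_left_inverse)
  qed
  then have "\<exists>B. g C p ** B = mat 1 \<and> B ** g C p = mat 1"
    by (simp add: invertible_def)
  then have inv: "ginv g C p ** g C p = mat 1"
    unfolding ginv_def matrix_inv_def by (rule someI2_ex) simp
  have sym: "g C p $ a $ b = g C p $ b $ a" for a b
    using arg_cong[OF assms(1), of "\<lambda>B. B $ a $ b"] by (simp add: transpose_def)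
  have "(\<Sum>b\<in>UNIV. ginv g C p $ a $ b * g C p $ a $ b) = 1" for a
  proof -
    have "(\<Sum>b\<in>UNIV. ginv g C p $ a $ b * g C p $ a $ b) = (ginv g C p ** g C p) $ a $ a"
      unfolding matrix_matrix_mult_def by (simp add: sym[of a])
    then show ?thesis
      by (simp add: inv mat_def)
  qed
  then show ?thesis
    unfolding metric_trace_def by simp
qed

lemma schouten_eq:
  fixes g :: "('m, 'n::finite) metric"
  assumes d: "CARD('n) \<ge> 3"
    and g: "transpose (g C p) = g C p" "\<And>v. v \<noteq> 0 \<Longrightarrow> v \<bullet> (g C p *v v) > 0"
  shows "ricci g C p =
    (real CARD('n) - 2) *\<^sub>R schouten g C p + metric_trace g C p (schouten g C p) *\<^sub>R g C p"
proof -
  let ?d = "real CARD('n)" and ?R = "ricci g C p"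
  let ?tr = "metric_trace g C p"
  have d3: "?d \<ge> 3" using d by simp
  have add: "?tr (B + B') = ?tr B + ?tr B'" for B B'
    by (simp add: metric_trace_def algebra_simps sum.distrib)
  have scale: "?tr (r *\<^sub>R B) = r * ?tr B" for r B
    by (simp add: metric_trace_def sum_distrib_left mult.left_commute)
  note trg = metric_trace_metric[of g C p, OF g]
  define J where "J = ?tr ?R / (2 * (?d - 1))"
  have sol: "(?R = (?d - 2) *\<^sub>R P + ?tr P *\<^sub>R g C p) \<longleftrightarrow> P = (1/(?d - 2)) *\<^sub>R (?R - J *\<^sub>R g C p)" for P
  proof
    assume eq: "?R = (?d - 2) *\<^sub>R P + ?tr P *\<^sub>R g C p"
    have "?tr ?R = (?d - 2) * ?tr P + ?tr P * ?d"
      by (subst eq) (simp add: add scale trg)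
    then have "?tr P = J"
      using d3 by (simp add: J_def field_simps)
    then have "(?d - 2) *\<^sub>R P = ?R - J *\<^sub>R g C p"
      using eq by simp
    then show "P = (1/(?d - 2)) *\<^sub>R (?R - J *\<^sub>R g C p)"
      using d3 by (simp flip: \<open>(?d - 2) *\<^sub>R P = ?R - J *\<^sub>R g C p\<close>)
  next
    assume P: "P = (1/(?d - 2)) *\<^sub>R (?R - J *\<^sub>R g C p)"
    have "?tr P = (?tr ?R - J * ?d) / (?d - 2)"
      using add[of ?R "(-J) *\<^sub>R g C p"] scale[of "-J" "g C p"] trg
      by (simp add: P scale)
    moreover have "?tr ?R = J * (2 * (?d - 1))"
      using d3 by (simp add: J_def)
    then have "?tr ?R - J * ?d = J * (?d - 2)"
      by (simp add: algebra_simps)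
    ultimately have "?tr P = J"
      using d3 by simp
    moreover have "(?d - 2) *\<^sub>R P = ?R - J *\<^sub>R g C p"
      using d3 by (simp add: P)
    ultimately show "?R = (?d - 2) *\<^sub>R P + ?tr P *\<^sub>R g C p"
      by simp
  qed
  have "\<exists>!P. ?R = (?d - 2) *\<^sub>R P + ?tr P *\<^sub>R g C p"
    by (simp add: sol)
  from theI'[OF this] show ?thesis
    by (simp add: schouten_def)
qed


section \<open>Conformal structures and densities\<close>

definition conf_related ::
  "('m, 'n::finite) chart set \<Rightarrow> ('m \<Rightarrow> real) \<Rightarrow> ('m, 'n) metric \<Rightarrow> ('m, 'n) metric \<Rightarrow> bool" where
  "conf_related A \<omega> g g' \<longleftrightarrow> smooth_fun A UNIV \<omega> \<and>
     (\<forall>C\<in>A. \<forall>p\<in>chart_dom C. g' C p = exp (2 * \<omega> p) *\<^sub>R g C p)"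

definition conformal_structure :: "('m, 'n::finite) chart set \<Rightarrow> ('m, 'n) metric set \<Rightarrow> bool" where
  "conformal_structure A c \<longleftrightarrow> (\<exists>g. riemannian_metric A UNIV g \<and>
     c = {g'. riemannian_metric A UNIV g' \<and> (\<exists>\<omega>. conf_related A \<omega> g g')})"

text \<open>A density is a family of functions, a weighted one-form (section of \<open>T\<^sup>*M[w]\<close>) a family of
  one-forms, both indexed by the scales \<open>g \<in> c\<close>.\<close>

type_synonym ('m, 'n) density = "('m, 'n) metric \<Rightarrow> 'm \<Rightarrow> real"
type_synonym ('m, 'n) weighted_form = "('m, 'n) metric \<Rightarrow> ('m, 'n) vec_comps"

definition is_density ::
  "('m, 'n::finite) chart set \<Rightarrow> ('m, 'n) metric set \<Rightarrow> real \<Rightarrow> ('m, 'n) density \<Rightarrow> bool" where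
  "is_density A c w f \<longleftrightarrow> (\<forall>g\<in>c. smooth_fun A UNIV (f g)) \<and>
     (\<forall>g\<in>c. \<forall>g'\<in>c. \<forall>\<omega>. conf_related A \<omega> g g' \<longrightarrow> (\<forall>p. f g' p = exp (w * \<omega> p) * f g p))"

definition is_weighted_form ::
  "('m, 'n::finite) chart set \<Rightarrow> ('m, 'n) metric set \<Rightarrow> real \<Rightarrow> ('m, 'n) weighted_form \<Rightarrow> bool" where
  "is_weighted_form A c w m \<longleftrightarrow> (\<forall>g\<in>c. smooth_one_form A UNIV (m g)) \<and>
     (\<forall>g\<in>c. \<forall>g'\<in>c. \<forall>\<omega>. conf_related A \<omega> g g' \<longrightarrow>
        (\<forall>C\<in>A. \<forall>p\<in>chart_dom C. m g' C p = exp (w * \<omega> p) *\<^sub>R m g C p))"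

text \<open>The tautological section of \<open>S\<^sup>2T\<^sup>*M[2]\<close>.\<close>

definition conformal_metric :: "('m, 'n::finite) metric \<Rightarrow> ('m, 'n) metric" where
  "conformal_metric s = s"


section \<open>Standard tractors\<close>

record ('m, 'n) triple =
  t_sigma :: "('m, 'n) density"
  t_mu :: "('m, 'n) weighted_form"
  t_rho :: "('m, 'n) density"

text \<open>\<open>U g\<close> is the triple identified with \<open>U\<close> by \<open>g \<in> c\<close>; its slots are themselves densities, and
  their values in a scale \<open>s \<in> c\<close> have a further argument \<open>s\<close>, independent of \<open>g\<close>.\<close>

type_synonym ('m, 'n) tractor = "('m, 'n) metric \<Rightarrow> ('m, 'n) triple"

definition tractor_transf ::
  "('m, 'n::finite) chart set \<Rightarrow> ('m, 'n) metric set \<Rightarrow> ('m \<Rightarrow> real) \<Rightarrow> ('m, 'n) triple \<Rightarrow> ('m, 'n) triple \<Rightarrow> bool" where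
  "tractor_transf A c \<omega> T T' \<longleftrightarrow> (\<forall>s\<in>c. \<forall>C\<in>A. \<forall>p\<in>chart_dom C.
     (let \<Upsilon> = (\<lambda>b. pdv C b \<omega> p);
          ig = (\<lambda>b k. ginv (conformal_metric s) C p $ b $ k);
          \<sigma> = t_sigma T s p; \<mu> = (\<lambda>b. t_mu T s C p $ b); \<rho> = t_rho T s p
      in t_sigma T' s p = \<sigma> \<and>
         (\<forall>b. t_mu T' s C p $ b = \<mu> b + \<sigma> * \<Upsilon> b) \<and>
         t_rho T' s p = \<rho> - (\<Sum>b\<in>UNIV. \<Sum>k\<in>UNIV. ig b k * \<Upsilon> b * \<mu> k)
           - (1/2) * \<sigma> * (\<Sum>b\<in>UNIV. \<Sum>k\<in>UNIV. ig b k * \<Upsilon> b * \<Upsilon> k)))"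

text \<open>Sections of \<open>T[w]\<close>; the standard tractor bundle is the case \<open>w = 0\<close>.\<close>

definition is_tractor ::
  "('m, 'n::finite) chart set \<Rightarrow> ('m, 'n) metric set \<Rightarrow> real \<Rightarrow> ('m, 'n) tractor \<Rightarrow> bool" where
  "is_tractor A c w U \<longleftrightarrow>
     (\<forall>g\<in>c. is_density A c (w + 1) (t_sigma (U g)) \<and> is_weighted_form A c (w + 1) (t_mu (U g)) \<and>
            is_density A c (w - 1) (t_rho (U g))) \<and>
     (\<forall>g\<in>c. \<forall>g'\<in>c. \<forall>\<omega>. conf_related A \<omega> g g' \<longrightarrow> tractor_transf A c \<omega> (U g) (U g'))"

text \<open>\<open>form_pairing A s m n p\<close> is \<open>s\<^sup>a\<^sup>b m\<^sub>a n\<^sub>b\<close> at \<open>p\<close>, computed in some chart around \<open>p\<close>; the value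
  does not depend on the chart.\<close>

definition form_pairing ::
  "('m, 'n::finite) chart set \<Rightarrow> ('m, 'n) metric \<Rightarrow> ('m, 'n) vec_comps \<Rightarrow> ('m, 'n) vec_comps \<Rightarrow> 'm \<Rightarrow> real" where
  "form_pairing A s m n p = (let C = (SOME C. C \<in> A \<and> p \<in> chart_dom C) in
     \<Sum>a\<in>UNIV. \<Sum>b\<in>UNIV. ginv s C p $ a $ b * m C p $ a * n C p $ b)"

text \<open>The polarised tractor metric.  For sections of \<open>T[w]\<close> and \<open>T[w']\<close> it yields a density of weight
  \<open>w + w'\<close>, whose value in the scale \<open>s\<close> is computed in the splitting given by \<open>s\<close>; any other
  splitting gives the same density.\<close>

definition tractor_metric ::
  "('m, 'n::finite) chart set \<Rightarrow> ('m, 'n) tractor \<Rightarrow> ('m, 'n) tractor \<Rightarrow> ('m, 'n) density" where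
  "tractor_metric A U V s p =
     t_sigma (U s) s p * t_rho (V s) s p + t_rho (U s) s p * t_sigma (V s) s p
     + form_pairing A (conformal_metric s) (t_mu (U s) s) (t_mu (V s) s) p"

definition canonical_tractor :: "('m, 'n::finite) tractor" where
  "canonical_tractor g = \<lparr>t_sigma = (\<lambda>s p. 0), t_mu = (\<lambda>s C p. 0), t_rho = (\<lambda>s p. 1)\<rparr>"

lemma tractor_metric_canonical:
  "tractor_metric A canonical_tractor U s p = t_sigma (U s) s p"
  by (simp add: tractor_metric_def canonical_tractor_def form_pairing_def Let_def)

text \<open>\<open>tractor_conn g C U a p\<close> lists the slots \<open>\<nabla>\<^sub>aU = (\<nabla>\<^sub>a\<sigma> - \<mu>\<^sub>a, (\<nabla>\<^sub>a\<mu>\<^sup>b + \<dots>)\<^sub>b, \<nabla>\<^sub>a\<rho> - \<dots>)\<close> in the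
  splitting given by \<open>g\<close>.  They are evaluated in the scale \<open>g\<close>, where the Levi-Civita connection of
  \<open>g\<close> on a density bundle is the trivial one and \<open>\<mu>\<^sup>b = g\<^sup>b\<^sup>k \<mu>\<^sub>k\<close>.\<close>

definition tractor_conn ::
  "('m, 'n::finite) metric \<Rightarrow> ('m, 'n) chart \<Rightarrow> ('m, 'n) tractor \<Rightarrow> 'n \<Rightarrow> 'm \<Rightarrow> real \<times> (real^'n) \<times> real" where
  "tractor_conn g C U a p =
     (let \<sigma> = t_sigma (U g) g; \<mu> = t_mu (U g) g C; \<rho> = t_rho (U g) g;
          \<mu>up = (\<lambda>q. ginv g C q *v \<mu> q)
      in (pdv C a \<sigma> p - \<mu> p $ a,
          (\<chi> b. nabla_vec g C \<mu>up a b p + (if a = b then \<rho> p else 0)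
                + (\<Sum>k\<in>UNIV. schouten g C p $ a $ k * ginv g C p $ k $ b) * \<sigma> p),
          pdv C a \<rho> p - (\<Sum>k\<in>UNIV. schouten g C p $ a $ k * \<mu>up p $ k)))"

definition parallel_tractor ::
  "('m, 'n::finite) chart set \<Rightarrow> ('m, 'n) metric set \<Rightarrow> ('m, 'n) tractor \<Rightarrow> bool" where
  "parallel_tractor A c K \<longleftrightarrow> is_tractor A c 0 K \<and>
     (\<forall>g\<in>c. \<forall>C\<in>A. \<forall>p\<in>chart_dom C. \<forall>a. tractor_conn g C K a p = 0)"

text \<open>Linear independence of sections: a combination that vanishes in every splitting, scale and chart
  is trivial.\<close>

definition tractors_independent ::
  "('m, 'n::finite) chart set \<Rightarrow> ('m, 'n) metric set \<Rightarrow> ('m, 'n) tractor \<Rightarrow> ('m, 'n) tractor \<Rightarrow> bool" where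
  "tractors_independent A c K L \<longleftrightarrow> (\<forall>x y :: real.
     (\<forall>g\<in>c. \<forall>s\<in>c. \<forall>C\<in>A. \<forall>p\<in>chart_dom C.
        x * t_sigma (K g) s p + y * t_sigma (L g) s p = 0 \<and>
        x *\<^sub>R t_mu (K g) s C p + y *\<^sub>R t_mu (L g) s C p = 0 \<and>
        x * t_rho (K g) s p + y * t_rho (L g) s p = 0) \<longrightarrow> x = 0 \<and> y = 0)"

definition scale_of :: "('m, 'n::finite) chart set \<Rightarrow> ('m, 'n) tractor \<Rightarrow> ('m, 'n) density" where
  "scale_of A K = tractor_metric A canonical_tractor K"

definition singularity_set ::
  "('m, 'n::finite) chart set \<Rightarrow> ('m, 'n) metric set \<Rightarrow> ('m, 'n) tractor \<Rightarrow> 'm set" where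
  "singularity_set A c K = {p. \<forall>s\<in>c. scale_of A K s p = 0}"

text \<open>The constant value of \<open>-h(K,K)\<close>, for \<open>K\<close> parallel and \<open>M\<close> connected.\<close>

definition S_const ::
  "('m, 'n::finite) chart set \<Rightarrow> ('m, 'n) metric set \<Rightarrow> ('m, 'n) tractor \<Rightarrow> real" where
  "S_const A c K = (THE r. \<forall>s\<in>c. \<forall>p. - tractor_metric A K K s p = r)"

text \<open>\<open>\<sigma>\<^sub>K\<^sup>-\<^sup>2 \<^bold>g\<close> has weight 0, so any scale may be used to evaluate it, cf. the lemma below.  Only
  meaningful away from the scale singularity set.\<close>

definition tractor_scale_metric ::
  "('m, 'n::finite) chart set \<Rightarrow> ('m, 'n) metric set \<Rightarrow> ('m, 'n) tractor \<Rightarrow> ('m, 'n) metric" where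
  "tractor_scale_metric A c K = (let s = (SOME s. s \<in> c) in
     (\<lambda>C p. (1 / (scale_of A K s p)\<^sup>2) *\<^sub>R conformal_metric s C p))"

lemma tractor_scale_metric_eq:
  assumes K: "is_tractor A c 0 K" and s: "s \<in> c" and C: "C \<in> A" "p \<in> chart_dom C"
    and s0: "s0 \<in> c" and rel: "conf_related A \<omega> s0 s"
  shows "(1 / (scale_of A K s p)\<^sup>2) *\<^sub>R conformal_metric s C p
       = (1 / (scale_of A K s0 p)\<^sup>2) *\<^sub>R conformal_metric s0 C p"
proof -
  have "is_density A c (0 + 1) (t_sigma (K s0))" and transf: "tractor_transf A c \<omega> (K s0) (K s)"
    using K s s0 rel unfolding is_tractor_def by blast+
  then have "t_sigma (K s0) s p = exp ((0 + 1) * \<omega> p) * t_sigma (K s0) s0 p"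
    using s s0 rel unfolding is_density_def by blast
  moreover have "t_sigma (K s) s p = t_sigma (K s0) s p"
    using bspec[OF bspec[OF bspec[OF transf[unfolded tractor_transf_def Let_def] s] C(1)] C(2)] by simp
  ultimately show ?thesis
    using rel C unfolding conf_related_def
    by (simp add: scale_of_def tractor_metric_canonical conformal_metric_def power_mult_distrib
        flip: exp_double)
qed


section \<open>Hypersurfaces\<close>

definition embedded_hypersurface ::
  "('m::topological_space, 'n::finite) chart set \<Rightarrow> 'm set \<Rightarrow> bool" where
  "embedded_hypersurface A S \<longleftrightarrow> (\<forall>p\<in>S. \<exists>U f. open U \<and> p \<in> U \<and> smooth_fun A U f \<and>
     S \<inter> U = {q\<in>U. f q = 0} \<and> (\<forall>C\<in>A. p \<in> chart_dom C \<longrightarrow> (\<exists>a. pdv C a f p \<noteq> 0)))"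

text \<open>\<open>tangent_to S C p\<close> is \<open>T\<^sub>pS\<close> in the chart \<open>C\<close>, as the set of velocities at \<open>p\<close> of curves in \<open>S\<close>.
  For an embedded hypersurface the curves that are merely differentiable at \<open>p\<close> have the same
  velocities as the smooth ones.\<close>

definition tangent_to :: "'m set \<Rightarrow> ('m, 'n::finite) chart \<Rightarrow> 'm \<Rightarrow> (real^'n) set" where
  "tangent_to S C p = {v. \<exists>\<gamma> :: real \<Rightarrow> 'm. \<gamma> 0 = p \<and>
     (\<exists>\<epsilon>>0. \<forall>t. \<bar>t\<bar> < \<epsilon> \<longrightarrow> \<gamma> t \<in> S \<inter> chart_dom C) \<and>
     ((\<lambda>t. chart_map C (\<gamma> t)) has_vector_derivative v) (at 0)}"

text \<open>\<open>N\<close> is smooth on the open set \<open>V\<close> and restricts to a unit normal field along \<open>S \<inter> V\<close>.\<close>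

definition unit_normal_field ::
  "('m::topological_space, 'n::finite) chart set \<Rightarrow> ('m, 'n) metric \<Rightarrow> 'm set \<Rightarrow> 'm set \<Rightarrow> ('m, 'n) vec_comps \<Rightarrow> bool" where
  "unit_normal_field A g S V N \<longleftrightarrow> open V \<and> smooth_vector_field A V N \<and>
     (\<forall>C\<in>A. \<forall>p \<in> S \<inter> V \<inter> chart_dom C. N C p \<bullet> (g C p *v N C p) = 1 \<and>
        (\<forall>v \<in> tangent_to S C p. N C p \<bullet> (g C p *v v) = 0))"

text \<open>\<open>II(u,v) = g(\<nabla>\<^sub>uN, v)\<close>.  On vectors tangent to \<open>S\<close> this depends only on \<open>N\<close> along \<open>S\<close>.\<close>

definition second_fundamental_form ::
  "('m, 'n::finite) metric \<Rightarrow> ('m, 'n) vec_comps \<Rightarrow> ('m, 'n) chart \<Rightarrow> 'm \<Rightarrow> real^'n \<Rightarrow> real^'n \<Rightarrow> real" where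
  "second_fundamental_form g N C p u v = (\<chi> b. \<Sum>a\<in>UNIV. u $ a * nabla_vec g C (N C) a b p) \<bullet> (g C p *v v)"

text \<open>The normalised trace of \<open>II\<close> over \<open>T\<^sub>pS\<close>: the inverse of the metric induced on \<open>S\<close>, as a tensor
  along \<open>S\<close>, is \<open>g\<^sup>a\<^sup>b - N\<^sup>aN\<^sup>b\<close>.\<close>

definition mean_curvature ::
  "('m, 'n::finite) metric \<Rightarrow> ('m, 'n) vec_comps \<Rightarrow> ('m, 'n) chart \<Rightarrow> 'm \<Rightarrow> real" where
  "mean_curvature g N C p = (1 / (real CARD('n) - 1)) *
     (\<Sum>a\<in>UNIV. \<Sum>b\<in>UNIV. (ginv g C p $ a $ b - N C p $ a * N C p $ b) *
        second_fundamental_form g N C p (axis a 1) (axis b 1))"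

text \<open>The conditions that do not depend on the sign of the normal are formulated with local normal
  fields, and constancy of the mean curvature with a normal field along all of \<open>S\<close>.\<close>

definition totally_umbilic ::
  "('m::topological_space, 'n::finite) chart set \<Rightarrow> ('m, 'n) metric \<Rightarrow> 'm set \<Rightarrow> bool" where
  "totally_umbilic A g S \<longleftrightarrow> (\<forall>p\<in>S. \<exists>V N. p \<in> V \<and> unit_normal_field A g S V N \<and>
     (\<exists>k. \<forall>C\<in>A. p \<in> chart_dom C \<longrightarrow> (\<forall>u \<in> tangent_to S C p. \<forall>v \<in> tangent_to S C p.
        second_fundamental_form g N C p u v = k * (u \<bullet> (g C p *v v)))))"

definition totally_geodesic ::
  "('m::topological_space, 'n::finite) chart set \<Rightarrow> ('m, 'n) metric \<Rightarrow> 'm set \<Rightarrow> bool" where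
  "totally_geodesic A g S \<longleftrightarrow> (\<forall>p\<in>S. \<exists>V N. p \<in> V \<and> unit_normal_field A g S V N \<and>
     (\<forall>C\<in>A. p \<in> chart_dom C \<longrightarrow> (\<forall>u \<in> tangent_to S C p. \<forall>v \<in> tangent_to S C p.
        second_fundamental_form g N C p u v = 0)))"

definition minimal_hypersurface ::
  "('m::topological_space, 'n::finite) chart set \<Rightarrow> ('m, 'n) metric \<Rightarrow> 'm set \<Rightarrow> bool" where
  "minimal_hypersurface A g S \<longleftrightarrow> (\<forall>p\<in>S. \<exists>V N. p \<in> V \<and> unit_normal_field A g S V N \<and>
     (\<forall>C\<in>A. p \<in> chart_dom C \<longrightarrow> mean_curvature g N C p = 0))"

definition constant_mean_curvature ::
  "('m::topological_space, 'n::finite) chart set \<Rightarrow> ('m, 'n) metric \<Rightarrow> 'm set \<Rightarrow> bool" where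
  "constant_mean_curvature A g S \<longleftrightarrow> (\<exists>V N. S \<subseteq> V \<and> unit_normal_field A g S V N \<and>
     (\<exists>H. \<forall>C\<in>A. \<forall>p \<in> S \<inter> chart_dom C. mean_curvature g N C p = H))"

end

theory Submission
  imports Defs
begin

text \<open>
  Let \<open>K1\<close> and \<open>K2\<close> have the slots \<open>(\<sigma>1, \<mu>1, \<rho>1)\<close> and \<open>(\<sigma>2, \<mu>2, \<rho>2)\<close> in a scale \<open>g\<close>.  Parallelism says
  that \<open>d\<sigma> = \<mu>\<close>, \<open>\<nabla>\<^sub>a\<mu>\<^sup>b = - \<rho> \<delta>\<^sub>a\<^sup>b - \<sigma> P\<^sub>a\<^sup>b\<close> and \<open>d\<rho> = P(\<mu>)\<close>.

  The function \<open>\<tau> = \<sigma>2 / \<sigma>1\<close> defines \<open>\<Sigma>\<close> off the zeros of \<open>\<sigma>1\<close>.  Its gradient for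
  \<open>g\<^sub>o = \<sigma>1\<^sup>-\<^sup>2 g\<close> is \<open>n = \<sigma>1 \<mu>2 - \<sigma>2 \<mu>1\<close>, and the second fundamental form of \<open>\<Sigma>\<close> is the Hessian of \<open>\<tau>\<close>
  divided by the length of \<open>n\<close>.  On \<open>\<Sigma>\<close> both are governed by the tractor metric:
  \<^item> the squared length of \<open>n\<close> for \<open>g\<^sub>o\<close> is that of \<open>\<mu>2\<close> for \<open>g\<close>, which is \<open>h(K2, K2) = - S\<close> because
    \<open>\<sigma>2 = 0\<close> there (\<open>gradient_length\<close>); as \<open>S < 0\<close>, the set \<open>\<Sigma>\<close> is a hypersurface and \<open>N = n / \<surd>(- S)\<close> restricts to a unit normal;
  \<^item> the Hessian is \<open>- (\<sigma>1 \<rho>2 + \<langle>\<mu>1, \<mu>2\<rangle>) = - h(K1, K2)\<close> times the metric (\<open>nabla_normal\<close>): the Schouten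
    terms of \<open>\<nabla>\<mu>1\<close> and \<open>\<nabla>\<mu>2\<close> cancel, and the mixed terms \<open>\<mu>1 \<otimes> \<mu>2 - \<mu>2 \<otimes> \<mu>1\<close> are removed by the
    change from the connection of \<open>g\<close> to that of \<open>g\<^sub>o\<close> (\<open>christoffel_conformal\<close>).

  So \<open>\<nabla>N\<close> is \<open>- h(K1, K2) / \<surd>(- S)\<close> times the identity along \<open>\<Sigma>\<close>, and \<open>\<Sigma>\<close> is totally umbilic with
  this number as its mean curvature.  It is constant because \<open>h\<close> of two parallel tractors has vanishing
  derivative (\<open>slots_pairing_constant\<close>) and the manifold is connected, and it is zero if \<open>K1\<close> and \<open>K2\<close>
  are orthogonal.  That \<open>S\<close>, a constant defined by all scales at once, exists, uses in addition the
  conformal invariance of \<open>h\<close> (\<open>tractor_metric_conformally_invariant\<close>).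
\<close>

section \<open>Calculus of smooth functions\<close>

lemma partial_eqI: "(f has_derivative D) (at x) \<Longrightarrow> partial a f x = D (axis a 1)"
  unfolding partial_def by (drule frechet_derivative_at) (erule arg_cong[THEN sym])

lemma has_derivative_cong_open:
  assumes "open S" "x \<in> S" and eq: "\<And>y. y \<in> S \<Longrightarrow> f y = g y"
  shows "(f has_derivative D) (at x) \<longleftrightarrow> (g has_derivative D) (at x)"
proof
  assume "(f has_derivative D) (at x)"
  then show "(g has_derivative D) (at x)"
    by (rule has_derivative_transform_within_open[OF _ assms(1,2)]) (simp add: eq)
next
  assume "(g has_derivative D) (at x)"
  then show "(f has_derivative D) (at x)"
    by (rule has_derivative_transform_within_open[OF _ assms(1,2)]) (simp add: eq)
qed

text \<open>\<open>partial\<close> picks the Frechet derivative with a choice operator, so that it depends only on the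
  germ of the function even where no derivative exists.\<close>

lemma partial_cong:
  assumes "open S" "x \<in> S" and eq: "\<And>y. y \<in> S \<Longrightarrow> f y = g y"
  shows "partial a f x = partial a g x"
  unfolding partial_def frechet_derivative_def
  by (simp add: has_derivative_cong_open[of S x f g] assms)

lemma differentiable_cong:
  assumes "open S" "x \<in> S" and eq: "\<And>y. y \<in> S \<Longrightarrow> f y = g y"
  shows "f differentiable (at x) \<longleftrightarrow> g differentiable (at x)"
  unfolding differentiable_def by (simp add: has_derivative_cong_open[of S x f g] assms)

lemma partial_const: "partial a (\<lambda>x. c) x = 0"
  using partial_eqI[OF has_derivative_const] .

lemma partial_add:
  assumes "f differentiable (at x)" "g differentiable (at x)"
  shows "partial a (\<lambda>x. f x + g x) x = partial a f x + partial a g x"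
  using partial_eqI[OF has_derivative_add[OF assms[THEN frechet_derivative_works[THEN iffD1]]]]
  unfolding partial_def by simp

lemma partial_mult:
  assumes "f differentiable (at x)" "g differentiable (at x)"
  shows "partial a (\<lambda>x. f x * g x) x = f x * partial a g x + partial a f x * g x"
  using partial_eqI[OF has_derivative_mult[OF assms[THEN frechet_derivative_works[THEN iffD1]]]]
  unfolding partial_def by simp

lemma partial_inverse:
  assumes "f differentiable (at x)" "f x \<noteq> 0"
  shows "partial a (\<lambda>x. inverse (f x)) x = - partial a f x * (inverse (f x) * inverse (f x))"
  using partial_eqI[OF Deriv.has_derivative_inverse[OF assms(2) assms(1)[THEN frechet_derivative_works[THEN iffD1]]]]
  unfolding partial_def by simp

text \<open>Closure of \<open>Ck_on\<close> under the algebraic operations goes by induction on the order: the product and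
  quotient rules express the partial derivatives by functions of lower order, but only on \<open>S\<close>.  As
  the recursion inspects \<open>partial a f\<close> as a function on the whole space, values outside the open set
  \<open>S\<close> must be discarded at every step.\<close>

lemma Ck_on_cong:
  assumes "open S"
  shows "(\<And>x. x \<in> S \<Longrightarrow> f x = g x) \<Longrightarrow> Ck_on k S f \<Longrightarrow> Ck_on k S g"
proof (induction k arbitrary: f g)
  case 0
  then show ?case using continuous_on_cong[of S S f g] by simp
next
  case (Suc k)
  have "Ck_on k S (partial a g)" for a
  proof (rule Suc.IH)
    show "partial a f x = partial a g x" if "x \<in> S" for x
      by (rule partial_cong[OF assms that Suc.prems(1)])
    show "Ck_on k S (partial a f)"
      using Suc.prems(2) by simp
  qed
  moreover have "g differentiable (at x)" if "x \<in> S" for x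
    using Suc.prems(2) that differentiable_cong[of S x f g, OF assms that Suc.prems(1)] by simp
  ultimately show ?case by simp
qed

lemma Ck_on_SucD: "Ck_on (Suc k) S f \<Longrightarrow> Ck_on k S f"
proof (induction k arbitrary: f)
  case 0
  then have "f differentiable_on S"
    by (simp add: differentiable_on_def differentiable_at_withinI)
  then show ?case
    by (simp add: differentiable_imp_continuous_on)
next
  case (Suc k)
  from Suc.prems have *: "\<forall>x\<in>S. f differentiable (at x)" "\<And>a. Ck_on (Suc k) S (partial a f)"
    unfolding Ck_on.simps(2)[of "Suc k"] by blast+
  with Suc.IH[OF *(2)] show ?case
    unfolding Ck_on.simps(2)[of k] by blast
qed

lemma Ck_on_subset: "Ck_on k S f \<Longrightarrow> T \<subseteq> S \<Longrightarrow> Ck_on k T f"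
proof (induction k arbitrary: f)
  case (Suc k)
  then have "Ck_on k T (partial a f)" for a
    by simp
  with Suc.prems show ?case by auto
qed (simp add: continuous_on_subset)

lemma Ck_on_const:
  fixes S :: "(real^'n::finite) set"
  shows "open S \<Longrightarrow> Ck_on k S (\<lambda>x. c)"
proof (induction k arbitrary: c)
  case (Suc k)
  moreover have "partial a (\<lambda>x. c) = (\<lambda>x. 0)" for a :: 'n
    by (rule ext) (rule partial_const)
  ultimately show ?case by simp
qed auto

lemma Ck_on_add:
  assumes "open S"
  shows "Ck_on k S f \<Longrightarrow> Ck_on k S g \<Longrightarrow> Ck_on k S (\<lambda>x. f x + g x)"
proof (induction k arbitrary: f g)
  case (Suc k)
  have "Ck_on k S (partial a (\<lambda>x. f x + g x))" for a
    by (rule Ck_on_cong[OF assms, rotated], rule Suc.IH[of "partial a f" "partial a g"])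
      (use Suc.prems in \<open>auto simp: partial_add\<close>)
  with Suc.prems show ?case by auto
qed (auto intro: continuous_on_add)

lemma Ck_on_mult:
  assumes "open S"
  shows "Ck_on k S f \<Longrightarrow> Ck_on k S g \<Longrightarrow> Ck_on k S (\<lambda>x. f x * g x)"
proof (induction k arbitrary: f g)
  case (Suc k)
  have fg: "Ck_on k S f" "Ck_on k S g"
    using Suc.prems[THEN Ck_on_SucD] by simp_all
  have "Ck_on k S (partial a (\<lambda>x. f x * g x))" for a
    by (rule Ck_on_cong[OF assms, rotated],
        rule Ck_on_add[OF assms Suc.IH[of f "partial a g"] Suc.IH[of "partial a f" g]])
      (use Suc.prems fg in \<open>auto simp: partial_mult\<close>)
  with Suc.prems show ?case by auto
qed (auto intro: continuous_on_mult)

lemma Ck_on_inverse: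
  assumes "open S" and nz: "\<And>x. x \<in> S \<Longrightarrow> f x \<noteq> 0"
  shows "Ck_on k S f \<Longrightarrow> Ck_on k S (\<lambda>x. inverse (f x))"
proof (induction k)
  case (Suc k)
  have IH: "Ck_on k S (\<lambda>x. inverse (f x))"
    by (rule Suc.IH[OF Ck_on_SucD[OF Suc.prems]])
  have "Ck_on k S (partial a (\<lambda>x. inverse (f x)))" for a
    by (rule Ck_on_cong[OF assms(1), rotated],
        rule Ck_on_mult[OF assms(1) Ck_on_mult[OF assms(1) Ck_on_const[OF assms(1), of _ "-1"], of _ "partial a f"]
          Ck_on_mult[OF assms(1) IH IH]])
      (use Suc.prems nz in \<open>auto simp: partial_inverse\<close>)
  with Suc.prems nz show ?case by (auto intro: differentiable_inverse)
qed (use nz in \<open>auto intro: continuous_on_inverse\<close>)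

lemma smooth_on_const: "open S \<Longrightarrow> smooth_on S (\<lambda>x. c)"
  by (simp add: smooth_on_def Ck_on_const)

lemma smooth_on_add: "open S \<Longrightarrow> smooth_on S f \<Longrightarrow> smooth_on S g \<Longrightarrow> smooth_on S (\<lambda>x. f x + g x)"
  by (simp add: smooth_on_def Ck_on_add)

lemma smooth_on_mult: "open S \<Longrightarrow> smooth_on S f \<Longrightarrow> smooth_on S g \<Longrightarrow> smooth_on S (\<lambda>x. f x * g x)"
  by (simp add: smooth_on_def Ck_on_mult)

lemma smooth_on_inverse:
  "open S \<Longrightarrow> (\<And>x. x \<in> S \<Longrightarrow> f x \<noteq> 0) \<Longrightarrow> smooth_on S f \<Longrightarrow> smooth_on S (\<lambda>x. inverse (f x))"
  by (simp add: smooth_on_def Ck_on_inverse)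

lemma smooth_on_cong:
  "open S \<Longrightarrow> (\<And>x. x \<in> S \<Longrightarrow> f x = g x) \<Longrightarrow> smooth_on S f \<Longrightarrow> smooth_on S g"
  unfolding smooth_on_def using Ck_on_cong[of S f g] by blast

lemma smooth_on_subset: "smooth_on S f \<Longrightarrow> T \<subseteq> S \<Longrightarrow> smooth_on T f"
  unfolding smooth_on_def using Ck_on_subset by blast

lemma smooth_on_sum:
  assumes "open S"
  shows "finite I \<Longrightarrow> (\<And>i. i \<in> I \<Longrightarrow> smooth_on S (f i)) \<Longrightarrow> smooth_on S (\<lambda>x. \<Sum>i\<in>I. f i x)"
  by (induction I rule: finite_induct) (auto intro: smooth_on_add smooth_on_const assms)

lemma smooth_on_prod:
  assumes "open S"
  shows "finite I \<Longrightarrow> (\<And>i. i \<in> I \<Longrightarrow> smooth_on S (f i)) \<Longrightarrow> smooth_on S (\<lambda>x. \<Prod>i\<in>I. f i x)"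
  by (induction I rule: finite_induct) (auto intro: smooth_on_mult smooth_on_const assms)

lemma smooth_on_differentiable: "smooth_on S f \<Longrightarrow> x \<in> S \<Longrightarrow> f differentiable (at x)"
  unfolding smooth_on_def using Ck_on.simps(2)[of 0 S f] by blast

lemma smooth_on_det:
  fixes B :: "real^'n::finite \<Rightarrow> real^'k^'k"
  assumes "open S" and "\<And>i j. smooth_on S (\<lambda>x. B x $ i $ j)"
  shows "smooth_on S (\<lambda>x. det (B x))"
  unfolding det_def
  by (intro smooth_on_sum smooth_on_mult smooth_on_prod smooth_on_const assms)
    (auto simp: finite_permutations)

lemma invertible_matrix_inv:
  fixes B :: "real^'n^'n"
  assumes "invertible B"
  shows "B ** matrix_inv B = mat 1" "matrix_inv B ** B = mat 1"
proof -
  have "\<exists>B'. B ** B' = mat 1 \<and> B' ** B = mat 1"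
    using assms by (simp add: invertible_def)
  then have "B ** matrix_inv B = mat 1 \<and> matrix_inv B ** B = mat 1"
    unfolding matrix_inv_def by (rule someI_ex)
  then show "B ** matrix_inv B = mat 1" "matrix_inv B ** B = mat 1" by auto
qed

lemma matrix_inv_eqI:
  fixes B :: "real^'n^'n"
  assumes "B ** B' = mat 1"
  shows "matrix_inv B = B'"
proof -
  have "invertible B"
    using assms matrix_left_right_inverse unfolding invertible_def by blast
  from invertible_matrix_inv(2)[OF this] show ?thesis
    by (metis assms matrix_mul_assoc matrix_mul_lid matrix_mul_rid)
qed

text \<open>By Cramer's rule the entries of the inverse are quotients of determinants, hence smooth in the
  entries of the matrix.\<close>

lemma matrix_inv_entry:
  fixes B :: "real^'k^'k"
  assumes "invertible B"
  shows "matrix_inv B $ i $ j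
    = det (\<chi> k l. if l = i then (if k = j then 1 else 0) else B $ k $ l) * inverse (det B)"
proof -
  have "B *v (matrix_inv B *v axis j 1) = axis j 1"
    by (simp add: matrix_vector_mul_assoc invertible_matrix_inv[OF assms])
  then have "matrix_inv B *v axis j 1
    = (\<chi> k. det (\<chi> i l. if l = k then axis j 1 $ i else B $ i $ l) / det B)"
    using cramer[of B "matrix_inv B *v axis j 1" "axis j 1"] assms
    by (simp add: invertible_det_nz)
  moreover have "matrix_inv B $ i $ j = (matrix_inv B *v axis j 1) $ i"
    by (simp add: matrix_vector_mul_component inner_axis)
  ultimately show ?thesis
    by (simp add: axis_def divide_inverse cong: if_cong)
qed

lemma smooth_on_matrix_inv:
  fixes B :: "real^'n::finite \<Rightarrow> real^'k^'k"
  assumes S: "open S" and B: "\<And>i j. smooth_on S (\<lambda>x. B x $ i $ j)"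
    and inv: "\<And>x. x \<in> S \<Longrightarrow> invertible (B x)"
  shows "smooth_on S (\<lambda>x. matrix_inv (B x) $ i $ j)"
proof (rule smooth_on_cong[OF S])
  have "smooth_on S (\<lambda>x. (\<chi> k l. if l = i then (if k = j then 1 else 0) else B x $ k $ l) $ k $ l)" for k l
    by (cases "l = i") (simp_all add: smooth_on_const S B)
  then show "smooth_on S (\<lambda>x. det (\<chi> k l. if l = i then (if k = j then 1 else 0) else B x $ k $ l)
      * inverse (det (B x)))"
    using inv by (intro smooth_on_mult smooth_on_inverse smooth_on_det S B)
      (simp_all add: invertible_det_nz)
qed (simp add: matrix_inv_entry inv)

section \<open>Coordinate derivatives\<close>

definition chart_diff :: "('m, 'n::finite) chart \<Rightarrow> ('m \<Rightarrow> real) \<Rightarrow> 'm \<Rightarrow> bool" where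
  "chart_diff C f p \<longleftrightarrow> (\<lambda>x. f (chart_inv C x)) differentiable (at (chart_map C p))"

definition chart_smooth :: "('m, 'n::finite) chart \<Rightarrow> ('m \<Rightarrow> real) \<Rightarrow> bool" where
  "chart_smooth C f \<longleftrightarrow> smooth_on (chart_map C ` chart_dom C) (\<lambda>x. f (chart_inv C x))"

lemma is_chartD:
  assumes "is_chart C"
  shows "open (chart_dom C)" "open (chart_map C ` chart_dom C)"
    "p \<in> chart_dom C \<Longrightarrow> chart_inv C (chart_map C p) = p"
    "x \<in> chart_map C ` chart_dom C \<Longrightarrow> chart_inv C x \<in> chart_dom C"
    "x \<in> chart_map C ` chart_dom C \<Longrightarrow> chart_map C (chart_inv C x) = x"
    "continuous_on (chart_dom C) (chart_map C)"
  using assms unfolding is_chart_def homeomorphism_def by auto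

lemma chart_smooth_diff: "chart_smooth C f \<Longrightarrow> p \<in> chart_dom C \<Longrightarrow> chart_diff C f p"
  unfolding chart_smooth_def chart_diff_def by (erule smooth_on_differentiable) simp

lemma chart_diff_const: "chart_diff C (\<lambda>q. c) p"
  by (simp add: chart_diff_def)

lemma chart_diff_add: "chart_diff C f p \<Longrightarrow> chart_diff C g p \<Longrightarrow> chart_diff C (\<lambda>q. f q + g q) p"
  by (simp add: chart_diff_def)

lemma chart_diff_mult: "chart_diff C f p \<Longrightarrow> chart_diff C g p \<Longrightarrow> chart_diff C (\<lambda>q. f q * g q) p"
  by (simp add: chart_diff_def)

lemma chart_diff_inverse:
  "is_chart C \<Longrightarrow> p \<in> chart_dom C \<Longrightarrow> f p \<noteq> 0 \<Longrightarrow> chart_diff C f p \<Longrightarrow> chart_diff C (\<lambda>q. inverse (f q)) p"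
  by (simp add: chart_diff_def differentiable_inverse is_chartD)

lemma chart_diff_sum:
  "finite I \<Longrightarrow> (\<And>i. i \<in> I \<Longrightarrow> chart_diff C (f i) p) \<Longrightarrow> chart_diff C (\<lambda>q. \<Sum>i\<in>I. f i q) p"
  by (induction I rule: finite_induct) (simp_all add: chart_diff_const chart_diff_add)

lemma pdv_const: "pdv C a (\<lambda>q. c) p = 0"
  by (simp add: pdv_def partial_const)

lemma pdv_add:
  "chart_diff C f p \<Longrightarrow> chart_diff C g p \<Longrightarrow> pdv C a (\<lambda>q. f q + g q) p = pdv C a f p + pdv C a g p"
  by (simp add: pdv_def chart_diff_def partial_add)

lemma pdv_mult:
  assumes "is_chart C" "p \<in> chart_dom C" "chart_diff C f p" "chart_diff C g p"
  shows "pdv C a (\<lambda>q. f q * g q) p = f p * pdv C a g p + pdv C a f p * g p"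
  using assms by (simp add: pdv_def chart_diff_def partial_mult is_chartD)

lemma pdv_inverse:
  assumes "is_chart C" "p \<in> chart_dom C" "chart_diff C f p" "f p \<noteq> 0"
  shows "pdv C a (\<lambda>q. inverse (f q)) p = - pdv C a f p * (inverse (f p) * inverse (f p))"
  using assms by (simp add: pdv_def chart_diff_def partial_inverse is_chartD)

lemma pdv_sum:
  "finite I \<Longrightarrow> (\<And>i. i \<in> I \<Longrightarrow> chart_diff C (f i) p) \<Longrightarrow>
    pdv C a (\<lambda>q. \<Sum>i\<in>I. f i q) p = (\<Sum>i\<in>I. pdv C a (f i) p)"
  by (induction I rule: finite_induct) (simp_all add: pdv_const pdv_add chart_diff_sum)

lemma pdv_cong:
  assumes "is_chart C" "p \<in> chart_dom C" "\<And>q. q \<in> chart_dom C \<Longrightarrow> f q = g q"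
  shows "pdv C a f p = pdv C a g p"
  unfolding pdv_def
  by (rule partial_cong[of "chart_map C ` chart_dom C"]) (use assms is_chartD[OF assms(1)] in auto)

lemma chart_diff_cong:
  assumes C: "is_chart C" and p: "p \<in> chart_dom C" and eq: "\<And>q. q \<in> chart_dom C \<Longrightarrow> f q = h q"
  shows "chart_diff C f p \<longleftrightarrow> chart_diff C h p"
  unfolding chart_diff_def
  by (rule differentiable_cong[of "chart_map C ` chart_dom C"]) (use assms is_chartD[OF C] in auto)

lemma linear_axis_expansion:
  fixes D :: "real^'n::finite \<Rightarrow> real"
  assumes "linear D"
  shows "D v = (\<Sum>a\<in>UNIV. v $ a * D (axis a 1))"
proof -
  have "D v = D (\<Sum>a\<in>UNIV. (v $ a) *\<^sub>R axis a 1)"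
    using basis_expansion[of v] by (simp add: scalar_mult_eq_scaleR)
  then show ?thesis
    using assms by (simp add: linear_sum linear_cmul)
qed

text \<open>The chain rule for a curve on the manifold: this is how velocities of curves in a hypersurface
  are seen to annihilate the differential of a defining function.\<close>

lemma chart_diff_along_curve:
  assumes C: "is_chart C" and f: "chart_diff C f (\<gamma> 0)"
    and \<gamma>: "\<epsilon> > 0" "\<And>t. \<bar>t\<bar> < \<epsilon> \<Longrightarrow> \<gamma> t \<in> chart_dom C"
    and v: "((\<lambda>t. chart_map C (\<gamma> t)) has_vector_derivative v) (at 0)"
  shows "((\<lambda>t. f (\<gamma> t)) has_vector_derivative (\<Sum>a\<in>UNIV. v $ a * pdv C a f (\<gamma> 0))) (at 0)"
proof -
  let ?F = "\<lambda>x. f (chart_inv C x)"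
  let ?D = "frechet_derivative ?F (at (chart_map C (\<gamma> 0)))"
  have D: "(?F has_derivative ?D) (at (chart_map C (\<gamma> 0)))"
    using f by (simp add: chart_diff_def frechet_derivative_works)
  have "?D v = (\<Sum>a\<in>UNIV. v $ a * pdv C a f (\<gamma> 0))"
    unfolding pdv_def partial_def
    by (rule linear_axis_expansion) (rule has_derivative_linear[OF D])
  moreover have "(?F \<circ> (\<lambda>t. chart_map C (\<gamma> t)) has_vector_derivative ?D v) (at 0)"
    using v D
    by (intro vector_derivative_diff_chain_within[where f' = v]) (auto intro: has_derivative_at_withinI)
  ultimately have "(?F \<circ> (\<lambda>t. chart_map C (\<gamma> t)) has_vector_derivative (\<Sum>a\<in>UNIV. v $ a * pdv C a f (\<gamma> 0))) (at 0)"
    by simp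
  then show ?thesis
    by (rule has_vector_derivative_transform_within_open[of _ _ _ "{-\<epsilon><..<\<epsilon>}"])
      (use \<gamma> is_chartD(3)[OF C] in \<open>auto simp: abs_less_iff\<close>)
qed

lemma chart_smooth_const: "is_chart C \<Longrightarrow> chart_smooth C (\<lambda>q. c)"
  by (simp add: chart_smooth_def smooth_on_const is_chartD)

lemma chart_smooth_add: "is_chart C \<Longrightarrow> chart_smooth C f \<Longrightarrow> chart_smooth C g \<Longrightarrow> chart_smooth C (\<lambda>q. f q + g q)"
  by (simp add: chart_smooth_def smooth_on_add is_chartD)

lemma chart_smooth_mult: "is_chart C \<Longrightarrow> chart_smooth C f \<Longrightarrow> chart_smooth C g \<Longrightarrow> chart_smooth C (\<lambda>q. f q * g q)"
  by (simp add: chart_smooth_def smooth_on_mult is_chartD)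

lemma chart_smooth_sum:
  "is_chart C \<Longrightarrow> finite I \<Longrightarrow> (\<And>i. i \<in> I \<Longrightarrow> chart_smooth C (f i)) \<Longrightarrow> chart_smooth C (\<lambda>q. \<Sum>i\<in>I. f i q)"
  by (simp add: chart_smooth_def smooth_on_sum is_chartD)

lemma smooth_fun_chart_smooth: "smooth_fun A UNIV f \<longleftrightarrow> (\<forall>C\<in>A. chart_smooth C f)"
  by (simp add: smooth_fun_def chart_smooth_def)

lemma chart_smooth_continuous_on:
  assumes "is_chart C" "chart_smooth C f"
  shows "continuous_on (chart_dom C) f"
proof -
  have "continuous_on (chart_map C ` chart_dom C) (\<lambda>x. f (chart_inv C x))"
    using assms(2) unfolding chart_smooth_def smooth_on_def by (metis Ck_on.simps(1))
  from continuous_on_compose2[OF this is_chartD(6)[OF assms(1)]] show ?thesis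
    by (rule continuous_on_eq) (auto simp: is_chartD(3)[OF assms(1)])
qed

lemma continuous_on_atlas:
  assumes A: "\<And>C. C \<in> A \<Longrightarrow> is_chart C" "(\<Union>C\<in>A. chart_dom C) = UNIV"
    and f: "\<And>C. C \<in> A \<Longrightarrow> chart_smooth C f"
  shows "continuous_on UNIV f"
proof -
  have "continuous_on (\<Union>C\<in>A. chart_dom C) f"
    by (rule continuous_on_open_UN) (use A f is_chartD(1) chart_smooth_continuous_on in blast)+
  then show ?thesis by (simp add: A)
qed

text \<open>A function with vanishing coordinate derivatives is constant on coordinate balls, hence locally
  constant.\<close>

lemma constant_if_pdv_eq_0:
  fixes A :: "('m::topological_space, 'n::finite) chart set" and f :: "'m \<Rightarrow> real"
  assumes A: "\<And>C. C \<in> A \<Longrightarrow> is_chart C" "(\<Union>C\<in>A. chart_dom C) = UNIV"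
    and conn: "connected (UNIV :: 'm set)"
    and f: "\<And>C p. C \<in> A \<Longrightarrow> p \<in> chart_dom C \<Longrightarrow> chart_diff C f p"
    and f0: "\<And>C p a. C \<in> A \<Longrightarrow> p \<in> chart_dom C \<Longrightarrow> pdv C a f p = 0"
  shows "f p = f q"
proof -
  have "f constant_on UNIV"
  proof (rule locally_constant_imp_constant[OF conn])
    fix p :: 'm
    obtain C where C: "C \<in> A" "p \<in> chart_dom C" using A(2) by blast
    note ch = is_chartD[OF A(1)[OF C(1)]]
    let ?F = "\<lambda>x. f (chart_inv C x)"
    obtain e where e: "e > 0" "ball (chart_map C p) e \<subseteq> chart_map C ` chart_dom C"
      using open_contains_ball[THEN iffD1, OF ch(2)] C(2) by blast
    have "(?F has_derivative (\<lambda>h. 0)) (at x)" if x: "x \<in> chart_map C ` chart_dom C" for x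
    proof -
      obtain y where y: "y \<in> chart_dom C" "x = chart_map C y" using x by auto
      let ?D = "frechet_derivative ?F (at x)"
      have D: "(?F has_derivative ?D) (at x)"
        using f[OF C(1) y(1)] y(2) by (simp add: chart_diff_def frechet_derivative_works)
      have "?D h = 0" for h
        using f0[OF C(1) y(1)] linear_axis_expansion[OF has_derivative_linear[OF D], of h] y(2)
        by (simp add: pdv_def partial_def)
      then have "?D = (\<lambda>h. 0)" by (rule ext)
      with D show ?thesis by (simp only:)
    qed
    then have "(?F has_derivative (\<lambda>h. 0)) (at x within ball (chart_map C p) e)"
      if "x \<in> ball (chart_map C p) e" for x
      by (rule has_derivative_at_withinI) (use that e(2) in blast)
    then obtain k where k: "\<And>x. x \<in> ball (chart_map C p) e \<Longrightarrow> ?F x = k"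
      using has_derivative_zero_constant[of "ball (chart_map C p) e" ?F] by auto
    let ?T = "chart_dom C \<inter> chart_map C -` ball (chart_map C p) e"
    have "open ?T"
      by (rule continuous_open_preimage[OF ch(6,1) open_ball])
    moreover have "f y = k" if "y \<in> ?T" for y
      using k[of "chart_map C y"] that by (simp add: ch(3))
    moreover have "p \<in> ?T"
      using C(2) e(1) by simp
    ultimately have "openin (top_of_set UNIV) ?T \<and> p \<in> ?T \<and> (\<forall>x\<in>?T. f x = f p)"
      by simp
    then show "\<exists>T. openin (top_of_set UNIV) T \<and> p \<in> T \<and> (\<forall>x\<in>T. f x = f p)"
      by (rule exI)
  qed
  then show ?thesis
    by (auto simp: constant_on_def)
qed

section \<open>Metrics in a chart\<close>

lemma positive_definite_invertible:
  fixes B :: "real^'n^'n"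
  assumes "\<And>v. v \<noteq> 0 \<Longrightarrow> v \<bullet> (B *v v) > 0"
  shows "invertible B"
proof -
  have "x = 0" if "B *v x = 0" for x
    using assms[of x] that by force
  then show ?thesis
    by (metis matrix_left_invertible_ker invertible_left_inverse)
qed

locale chart_metric =
  fixes C :: "('m::topological_space, 'n::finite) chart" and g :: "('m, 'n) metric"
  assumes chart: "is_chart C"
    and smooth: "\<And>i j. chart_smooth C (\<lambda>q. g C q $ i $ j)"
    and sym: "\<And>p. p \<in> chart_dom C \<Longrightarrow> transpose (g C p) = g C p"
    and pos: "\<And>p v. p \<in> chart_dom C \<Longrightarrow> v \<noteq> 0 \<Longrightarrow> v \<bullet> (g C p *v v) > 0"
begin

lemma g_inverse:
  assumes "p \<in> chart_dom C"
  shows "g C p ** ginv g C p = mat 1" "ginv g C p ** g C p = mat 1"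
  unfolding ginv_def
  by (intro invertible_matrix_inv positive_definite_invertible pos[OF assms]; assumption)+

lemma ginv_g_vec: "p \<in> chart_dom C \<Longrightarrow> ginv g C p *v (g C p *v v) = v"
  by (simp add: matrix_vector_mul_assoc g_inverse)

lemma g_ginv_vec: "p \<in> chart_dom C \<Longrightarrow> g C p *v (ginv g C p *v v) = v"
  by (simp add: matrix_vector_mul_assoc g_inverse)

lemma g_sym: "p \<in> chart_dom C \<Longrightarrow> g C p $ i $ j = g C p $ j $ i"
  using arg_cong[OF sym, of p "\<lambda>B. B $ i $ j"] by (simp add: transpose_def)

lemma g_inner_sym: "p \<in> chart_dom C \<Longrightarrow> u \<bullet> (g C p *v v) = v \<bullet> (g C p *v u)"
  using dot_lmul_matrix[of u "g C p" v] sym by (metis inner_commute transpose_matrix_vector)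

lemma ginv_sym:
  assumes p: "p \<in> chart_dom C"
  shows "ginv g C p $ i $ j = ginv g C p $ j $ i"
proof -
  have "g C p ** transpose (ginv g C p) = transpose (ginv g C p ** g C p)"
    by (simp add: matrix_transpose_mul sym[OF p])
  then have "ginv g C p = transpose (ginv g C p)"
    unfolding ginv_def[of g C p] by (intro matrix_inv_eqI) (simp add: g_inverse[OF p] transpose_mat flip: ginv_def)
  from arg_cong[OF this, of "\<lambda>B. B $ i $ j"] show ?thesis
    by (simp add: transpose_def)
qed

lemma smooth_ginv: "chart_smooth C (\<lambda>q. ginv g C q $ i $ j)"
  unfolding chart_smooth_def ginv_def
proof (rule smooth_on_matrix_inv)
  show "invertible (g C (chart_inv C x))" if "x \<in> chart_map C ` chart_dom C" for x
    using pos is_chartD(4)[OF chart that] by (intro positive_definite_invertible) blast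
qed (use smooth in \<open>simp_all add: is_chartD[OF chart] chart_smooth_def\<close>)

definition christoffel_lowered :: "'n \<Rightarrow> 'n \<Rightarrow> 'n \<Rightarrow> 'm \<Rightarrow> real" where
  "christoffel_lowered a b l p =
    (1/2) * (pdv C a (\<lambda>q. g C q $ b $ l) p + pdv C b (\<lambda>q. g C q $ a $ l) p - pdv C l (\<lambda>q. g C q $ a $ b) p)"

lemma christoffel_eq: "(\<chi> k. christoffel g C a b k p) = ginv g C p *v (\<chi> l. christoffel_lowered a b l p)"
  by (simp add: vec_eq_iff christoffel_def christoffel_lowered_def matrix_vector_mult_def sum_distrib_left algebra_simps)

lemma pdv_g_sym: "p \<in> chart_dom C \<Longrightarrow> pdv C a (\<lambda>q. g C q $ i $ j) p = pdv C a (\<lambda>q. g C q $ j $ i) p"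
  by (rule pdv_cong[OF chart]) (auto intro: g_sym)

text \<open>The two lowered symbols on the right share the derivatives of \<open>g\<close> along \<open>b\<close> and \<open>c\<close> with
  opposite signs; symmetry of \<open>g\<close> leaves the derivative along \<open>a\<close>.\<close>

lemma metric_compatible:
  assumes p: "p \<in> chart_dom C"
  shows "pdv C a (\<lambda>q. g C q $ b $ c) p =
    (\<Sum>k\<in>UNIV. g C p $ c $ k * christoffel g C a b k p) + (\<Sum>k\<in>UNIV. g C p $ b $ k * christoffel g C a c k p)"
proof -
  have *: "(\<Sum>k\<in>UNIV. g C p $ l $ k * christoffel g C a b k p) = christoffel_lowered a b l p" for b l
  proof -
    have "(\<Sum>k\<in>UNIV. g C p $ l $ k * christoffel g C a b k p) = (g C p *v (\<chi> k. christoffel g C a b k p)) $ l"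
      by (simp add: matrix_vector_mult_def)
    then show ?thesis
      by (simp add: christoffel_eq g_ginv_vec[OF p])
  qed
  show ?thesis
    unfolding * christoffel_lowered_def
    using pdv_g_sym[OF p, of a b c] pdv_g_sym[OF p, of b a c] pdv_g_sym[OF p, of c a b]
    by (simp add: field_simps)
qed

text \<open>The conformal change of the Levi-Civita connection, with \<open>\<Upsilon> = - d\<sigma> / \<sigma>\<close>: with the index lowered,
  the two connections differ by the derivatives of the factor \<open>\<sigma>\<^sup>-\<^sup>2\<close>, which \<open>w\<close> collects below.\<close>

lemma christoffel_conformal:
  assumes p: "p \<in> chart_dom C" and \<sigma>: "chart_diff C \<sigma> p" "\<sigma> p \<noteq> 0"
    and g': "\<And>q. g' C q = (1 / (\<sigma> q)\<^sup>2) *\<^sub>R g C q"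
  shows "christoffel g' C a b k p = christoffel g C a b k p -
    (pdv C a \<sigma> p * (if k = b then 1 else 0) + pdv C b \<sigma> p * (if k = a then 1 else 0)
      - g C p $ a $ b * (ginv g C p *v (\<chi> l. pdv C l \<sigma> p)) $ k) / \<sigma> p"
proof -
  define d where "d = (\<chi> l. pdv C l \<sigma> p)"
  have dg': "pdv C a (\<lambda>q. g' C q $ i $ j) p
    = (1 / (\<sigma> p)\<^sup>2) * pdv C a (\<lambda>q. g C q $ i $ j) p - 2 * d $ a * g C p $ i $ j / (\<sigma> p)^3" for a i j
  proof -
    have "(\<lambda>q. g' C q $ i $ j) = (\<lambda>q. inverse (\<sigma> q * \<sigma> q) * g C q $ i $ j)"
      by (simp add: g' power2_eq_square field_simps)
    moreover have "chart_diff C (\<lambda>q. \<sigma> q * \<sigma> q) p"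
      by (intro chart_diff_mult \<sigma>)
    ultimately have "pdv C a (\<lambda>q. g' C q $ i $ j) p
      = inverse (\<sigma> p * \<sigma> p) * pdv C a (\<lambda>q. g C q $ i $ j) p
        + - (\<sigma> p * d $ a + d $ a * \<sigma> p) * (inverse (\<sigma> p * \<sigma> p) * inverse (\<sigma> p * \<sigma> p)) * g C p $ i $ j"
      using \<sigma> chart_smooth_diff[OF smooth p]
      by (simp add: pdv_mult[OF chart p] pdv_inverse[OF chart p] chart_diff_inverse[OF chart p] d_def
          del: inverse_mult_distrib)
    then show ?thesis
      using \<sigma>(2) by (simp add: field_simps power2_eq_square power3_eq_cube)
  qed
  have ginv': "ginv g' C p = (\<sigma> p)\<^sup>2 *\<^sub>R ginv g C p"
    unfolding ginv_def[of g'] g'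
    by (rule matrix_inv_eqI) (use \<sigma> g_inverse[OF p] in \<open>simp add: matrix_scalar_ac flip: scalar_matrix_assoc\<close>)
  define w where "w = (\<chi> l. d $ a * g C p $ b $ l + d $ b * g C p $ a $ l - d $ l * g C p $ a $ b)"
  have row: "ginv g C p *v (g C p $ i) = axis i 1" for i
  proof -
    have "g C p $ i = g C p *v axis i 1"
      by (simp add: vec_eq_iff matrix_vector_mul_component inner_axis g_sym[OF p, of i])
    then show ?thesis
      by (simp only: ginv_g_vec[OF p])
  qed
  have "w = d $ a *\<^sub>R (g C p $ b) + d $ b *\<^sub>R (g C p $ a) - g C p $ a $ b *\<^sub>R d"
    by (simp add: w_def vec_eq_iff)
  then have up: "ginv g C p *v w = d $ a *\<^sub>R axis b 1 + d $ b *\<^sub>R axis a 1 - g C p $ a $ b *\<^sub>R (ginv g C p *v d)"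
    by (simp add: row matrix_vector_right_distrib matrix_vector_mult_diff_distrib matrix_vector_mult_scaleR)
  have "christoffel g' C a b k p = (\<Sum>l\<in>UNIV. ginv g C p $ k $ l * (christoffel_lowered a b l p - w $ l / \<sigma> p))"
    unfolding christoffel_def ginv' dg' sum_distrib_left christoffel_lowered_def w_def
    by (intro sum.cong refl) (use \<sigma> in \<open>simp add: field_simps power2_eq_square power3_eq_cube\<close>)
  also have "\<dots> = christoffel g C a b k p - (ginv g C p *v w) $ k / \<sigma> p"
    using arg_cong[OF christoffel_eq[of a b p], of "\<lambda>v. v $ k"]
    by (simp add: matrix_vector_mult_def algebra_simps sum_subtractf sum_divide_distrib)
  finally show ?thesis
    unfolding up by (simp add: d_def axis_def)
qed

end

section \<open>Parallel tractors in a chart\<close>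

definition raise_index :: "('m, 'n::finite) metric \<Rightarrow> ('m, 'n) chart \<Rightarrow> ('m \<Rightarrow> real^'n) \<Rightarrow> 'm \<Rightarrow> real^'n" where
  "raise_index g C \<mu> q = ginv g C q *v \<mu> q"

text \<open>The equations that say that the tractor \<open>(\<sigma>, \<mu>, \<rho>)\<close> is parallel, with a matrix field \<open>P\<close> in the
  place of the Schouten tensor.  In the computations below \<open>P\<close> cancels, because it enters \<open>\<nabla>\<mu>\<close> and
  \<open>\<nabla>\<rho>\<close> with opposite signs, and symmetrically in two parallel tractors.\<close>

definition parallel_slots ::
  "('m, 'n::finite) metric \<Rightarrow> ('m, 'n) chart \<Rightarrow> ('m \<Rightarrow> real^'n^'n) \<Rightarrow> ('m \<Rightarrow> real) \<Rightarrow> ('m \<Rightarrow> real^'n) \<Rightarrow> ('m \<Rightarrow> real) \<Rightarrow> bool" where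
  "parallel_slots g C P \<sigma> \<mu> \<rho> \<longleftrightarrow>
     chart_smooth C \<sigma> \<and> (\<forall>b. chart_smooth C (\<lambda>q. \<mu> q $ b)) \<and> chart_smooth C \<rho> \<and>
     (\<forall>p\<in>chart_dom C. \<forall>a. pdv C a \<sigma> p = \<mu> p $ a \<and>
        (\<chi> b. nabla_vec g C (raise_index g C \<mu>) a b p) = - \<rho> p *\<^sub>R axis a 1 - \<sigma> p *\<^sub>R (ginv g C p *v P p $ a) \<and>
        pdv C a \<rho> p = P p $ a \<bullet> raise_index g C \<mu> p)"

definition slots_pairing ::
  "('m, 'n::finite) metric \<Rightarrow> ('m, 'n) chart \<Rightarrow> ('m \<Rightarrow> real) \<Rightarrow> ('m \<Rightarrow> real^'n) \<Rightarrow> ('m \<Rightarrow> real) \<Rightarrow> ('m \<Rightarrow> real) \<Rightarrow> ('m \<Rightarrow> real^'n) \<Rightarrow> ('m \<Rightarrow> real) \<Rightarrow> 'm \<Rightarrow> real" where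
  "slots_pairing g C \<sigma> \<mu> \<rho> \<sigma>' \<mu>' \<rho>' q = \<sigma> q * \<rho>' q + \<rho> q * \<sigma>' q + \<mu> q \<bullet> raise_index g C \<mu>' q"

context chart_metric
begin

text \<open>Metric compatibility as a Leibniz rule: the Christoffel symbols that make up the derivative of
  \<open>g\<close> are split between the two vector fields.\<close>

lemma pdv_g_inner:
  assumes p: "p \<in> chart_dom C"
    and X: "\<And>b. chart_smooth C (\<lambda>q. X q $ b)" and Y: "\<And>b. chart_smooth C (\<lambda>q. Y q $ b)"
  shows "pdv C a (\<lambda>q. X q \<bullet> (g C q *v Y q)) p =
    X p \<bullet> (g C p *v (\<chi> b. nabla_vec g C Y a b p)) + Y p \<bullet> (g C p *v (\<chi> b. nabla_vec g C X a b p))"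
proof -
  note diff = chart_smooth_diff[OF _ p]
  define DX DY where "DX = (\<chi> b. pdv C a (\<lambda>q. X q $ b) p)" and "DY = (\<chi> b. pdv C a (\<lambda>q. Y q $ b) p)"
  define GX GY where "GX = (\<chi> b. \<Sum>k\<in>UNIV. christoffel g C a k b p * X p $ k)"
    and "GY = (\<chi> b. \<Sum>k\<in>UNIV. christoffel g C a k b p * Y p $ k)"
  have expand: "u \<bullet> (B *v v) = (\<Sum>b\<in>UNIV. \<Sum>c\<in>UNIV. B $ b $ c * (u $ b * v $ c))" for u v :: "real^'n" and B :: "real^'n^'n"
    by (simp add: inner_vec_def matrix_vector_mult_def sum_distrib_left mult_ac)
  have "pdv C a (\<lambda>q. X q \<bullet> (g C q *v Y q)) p =
    (\<Sum>b\<in>UNIV. \<Sum>c\<in>UNIV. g C p $ b $ c * (X p $ b * DY $ c + DX $ b * Y p $ c)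
      + pdv C a (\<lambda>q. g C q $ b $ c) p * (X p $ b * Y p $ c))"
    unfolding expand DX_def DY_def
    by (simp add: pdv_sum pdv_mult[OF chart p] chart_diff_sum chart_diff_mult diff[OF smooth] diff[OF X] diff[OF Y])
  also have "\<dots> = X p \<bullet> (g C p *v DY) + DX \<bullet> (g C p *v Y p)
      + (\<Sum>b\<in>UNIV. \<Sum>c\<in>UNIV. pdv C a (\<lambda>q. g C q $ b $ c) p * (X p $ b * Y p $ c))"
    unfolding expand by (simp add: sum.distrib algebra_simps)
  also have "(\<Sum>b\<in>UNIV. \<Sum>c\<in>UNIV. pdv C a (\<lambda>q. g C q $ b $ c) p * (X p $ b * Y p $ c))
    = (\<Sum>b\<in>UNIV. \<Sum>c\<in>UNIV. (\<Sum>k\<in>UNIV. g C p $ c $ k * christoffel g C a b k p) * (X p $ b * Y p $ c))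
      + (\<Sum>b\<in>UNIV. \<Sum>c\<in>UNIV. (\<Sum>k\<in>UNIV. g C p $ b $ k * christoffel g C a c k p) * (X p $ b * Y p $ c))"
    by (simp add: metric_compatible[OF p] sum.distrib algebra_simps)
  also have "(\<Sum>b\<in>UNIV. \<Sum>c\<in>UNIV. (\<Sum>k\<in>UNIV. g C p $ c $ k * christoffel g C a b k p) * (X p $ b * Y p $ c))
    = Y p \<bullet> (g C p *v GX)"
  proof -
    have "(\<Sum>b\<in>UNIV. \<Sum>c\<in>UNIV. (\<Sum>k\<in>UNIV. g C p $ c $ k * christoffel g C a b k p) * (X p $ b * Y p $ c))
      = (\<Sum>b\<in>UNIV. \<Sum>c\<in>UNIV. \<Sum>k\<in>UNIV. g C p $ c $ k * (Y p $ c * (christoffel g C a b k p * X p $ b)))"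
      unfolding sum_distrib_right by (simp add: mult_ac)
    also have "\<dots> = (\<Sum>c\<in>UNIV. \<Sum>b\<in>UNIV. \<Sum>k\<in>UNIV. g C p $ c $ k * (Y p $ c * (christoffel g C a b k p * X p $ b)))"
      by (rule sum.swap)
    also have "\<dots> = (\<Sum>c\<in>UNIV. \<Sum>k\<in>UNIV. \<Sum>b\<in>UNIV. g C p $ c $ k * (Y p $ c * (christoffel g C a b k p * X p $ b)))"
      by (intro sum.cong refl sum.swap)
    finally show ?thesis
      by (simp add: expand GX_def sum_distrib_left)
  qed
  also have "(\<Sum>b\<in>UNIV. \<Sum>c\<in>UNIV. (\<Sum>k\<in>UNIV. g C p $ b $ k * christoffel g C a c k p) * (X p $ b * Y p $ c))
    = X p \<bullet> (g C p *v GY)"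
  proof -
    have "(\<Sum>b\<in>UNIV. \<Sum>c\<in>UNIV. (\<Sum>k\<in>UNIV. g C p $ b $ k * christoffel g C a c k p) * (X p $ b * Y p $ c))
      = (\<Sum>b\<in>UNIV. \<Sum>c\<in>UNIV. \<Sum>k\<in>UNIV. g C p $ b $ k * (X p $ b * (christoffel g C a c k p * Y p $ c)))"
      unfolding sum_distrib_right by (simp add: mult_ac)
    also have "\<dots> = (\<Sum>b\<in>UNIV. \<Sum>k\<in>UNIV. \<Sum>c\<in>UNIV. g C p $ b $ k * (X p $ b * (christoffel g C a c k p * Y p $ c)))"
      by (intro sum.cong refl sum.swap)
    finally show ?thesis
      by (simp add: expand GY_def sum_distrib_left)
  qed
  also have "X p \<bullet> (g C p *v DY) + DX \<bullet> (g C p *v Y p) + (Y p \<bullet> (g C p *v GX) + X p \<bullet> (g C p *v GY))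
    = X p \<bullet> (g C p *v (DY + GY)) + Y p \<bullet> (g C p *v (DX + GX))"
    using g_inner_sym[OF p, of DX "Y p"] by (simp add: matrix_vector_right_distrib inner_add_right)
  also have "DY + GY = (\<chi> b. nabla_vec g C Y a b p)"
    by (simp add: vec_eq_iff DY_def GY_def nabla_vec_def)
  also have "DX + GX = (\<chi> b. nabla_vec g C X a b p)"
    by (simp add: vec_eq_iff DX_def GX_def nabla_vec_def)
  finally show ?thesis .
qed

lemma smooth_raise:
  assumes "\<And>b. chart_smooth C (\<lambda>q. \<mu> q $ b)"
  shows "chart_smooth C (\<lambda>q. raise_index g C \<mu> q $ b)"
  unfolding raise_index_def matrix_vector_mult_def
  by (simp add: chart_smooth_sum chart_smooth_mult chart smooth_ginv assms)

lemma g_raise: "p \<in> chart_dom C \<Longrightarrow> g C p *v raise_index g C \<mu> p = \<mu> p"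
  by (simp add: raise_index_def g_ginv_vec)

text \<open>The tractor connection preserves the tractor metric: in the derivative of
  \<open>\<sigma>\<rho>' + \<rho>\<sigma>' + \<langle>\<mu>, \<mu>'\<rangle>\<close> the terms \<open>\<rho>'\<mu>\<^sub>a\<close> and \<open>\<rho>\<mu>'\<^sub>a\<close> coming from \<open>d\<sigma>\<close> and \<open>d\<sigma>'\<close>, and the terms
  \<open>\<sigma> P(\<mu>')\<^sub>a\<close> and \<open>\<sigma>' P(\<mu>)\<^sub>a\<close> coming from \<open>d\<rho>'\<close> and \<open>d\<rho>\<close>, cancel against those of \<open>\<nabla>\<mu>\<close> and \<open>\<nabla>\<mu>'\<close>.\<close>

lemma slots_pairing_constant:
  assumes 1: "parallel_slots g C P \<sigma> \<mu> \<rho>" and 2: "parallel_slots g C P \<sigma>' \<mu>' \<rho>'" and p: "p \<in> chart_dom C"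
  shows "chart_diff C (slots_pairing g C \<sigma> \<mu> \<rho> \<sigma>' \<mu>' \<rho>') p" "pdv C a (slots_pairing g C \<sigma> \<mu> \<rho> \<sigma>' \<mu>' \<rho>') p = 0"
proof -
  note S1 = 1[unfolded parallel_slots_def] and S2 = 2[unfolded parallel_slots_def]
  have M: "chart_smooth C (\<lambda>q. raise_index g C \<mu> q $ b)" "chart_smooth C (\<lambda>q. raise_index g C \<mu>' q $ b)" for b
    using S1 S2 by (simp_all add: smooth_raise)
  have inner: "chart_smooth C (\<lambda>q. \<mu> q \<bullet> raise_index g C \<mu>' q)"
    unfolding inner_vec_def using S1 M by (simp add: chart_smooth_sum chart_smooth_mult chart)
  have d: "chart_diff C (\<lambda>q. \<mu> q \<bullet> raise_index g C \<mu>' q) p" "chart_diff C \<sigma> p" "chart_diff C \<sigma>' p" "chart_diff C \<rho> p" "chart_diff C \<rho>' p"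
    using inner S1 S2 by (simp_all add: chart_smooth_diff[OF _ p])
  show "chart_diff C (slots_pairing g C \<sigma> \<mu> \<rho> \<sigma>' \<mu>' \<rho>') p"
    unfolding slots_pairing_def[abs_def] by (intro chart_diff_add chart_diff_mult d)
  have flat: "raise_index g C \<mu> p \<bullet> (g C p *v axis a 1) = \<mu> p $ a" for \<mu>
    by (simp add: g_inner_sym[OF p, of "raise_index g C \<mu> p"] g_raise[OF p] inner_axis')
  have "pdv C a (\<lambda>q. \<mu> q \<bullet> raise_index g C \<mu>' q) p = pdv C a (\<lambda>q. raise_index g C \<mu> q \<bullet> (g C q *v raise_index g C \<mu>' q)) p"
    by (rule pdv_cong[OF chart p])
      (metis g_inner_sym g_raise inner_commute)
  also have "\<dots> = raise_index g C \<mu> p \<bullet> (g C p *v (- \<rho>' p *\<^sub>R axis a 1 - \<sigma>' p *\<^sub>R (ginv g C p *v P p $ a)))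
      + raise_index g C \<mu>' p \<bullet> (g C p *v (- \<rho> p *\<^sub>R axis a 1 - \<sigma> p *\<^sub>R (ginv g C p *v P p $ a)))"
    using S1 S2 p by (simp add: pdv_g_inner M)
  also have "\<dots> = - \<rho>' p * \<mu> p $ a - \<sigma>' p * (P p $ a \<bullet> raise_index g C \<mu> p) - \<rho> p * \<mu>' p $ a - \<sigma> p * (P p $ a \<bullet> raise_index g C \<mu>' p)"
    by (simp add: matrix_vector_mult_diff_distrib matrix_vector_mult_scaleR vec.neg g_ginv_vec[OF p] flat
        inner_diff_right inner_commute)
  finally show "pdv C a (slots_pairing g C \<sigma> \<mu> \<rho> \<sigma>' \<mu>' \<rho>') p = 0"
    unfolding slots_pairing_def[abs_def] using S1 S2 p d
    by (simp add: pdv_add pdv_mult[OF chart p] chart_diff_add chart_diff_mult)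
qed

text \<open>This is the computation that the theorem rests on.  The vector field \<open>n = \<sigma> \<mu>' - \<sigma>' \<mu>\<close> is the
  gradient of \<open>\<sigma>' / \<sigma>\<close> for the metric \<open>g' = \<sigma>\<^sup>-\<^sup>2 g\<close>, so its covariant derivative is the Hessian of
  that function.  For \<open>g\<close>, and where \<open>\<sigma>' = 0\<close>,
  \<open>\<nabla>\<^sub>a n\<^sup>b = \<mu>\<^sub>a \<mu>'\<^sup>b - \<mu>'\<^sub>a \<mu>\<^sup>b - \<sigma> \<rho>' \<delta>\<^sub>a\<^sup>b\<close>.
  The change of connection from \<open>g\<close> to \<open>g'\<close> removes the two mixed terms and adds
  \<open>- \<langle>\<mu>, \<mu>'\<rangle> \<delta>\<^sub>a\<^sup>b\<close>.  What remains is minus the pairing of the two tractors times the identity.\<close>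

lemma nabla_normal:
  assumes 1: "parallel_slots g C P \<sigma> \<mu> \<rho>" and 2: "parallel_slots g C P \<sigma>' \<mu>' \<rho>'" and p: "p \<in> chart_dom C"
    and nz: "\<sigma> p \<noteq> 0" and z: "\<sigma>' p = 0" and g': "\<And>q. g' C q = (1 / (\<sigma> q)\<^sup>2) *\<^sub>R g C q"
  shows "nabla_vec g' C (\<lambda>q. r *\<^sub>R (\<sigma> q *\<^sub>R raise_index g C \<mu>' q - \<sigma>' q *\<^sub>R raise_index g C \<mu> q)) a b p
    = - r * slots_pairing g C \<sigma> \<mu> \<rho> \<sigma>' \<mu>' \<rho>' p * (if a = b then 1 else 0)"
proof -
  note S1 = 1[unfolded parallel_slots_def] and S2 = 2[unfolded parallel_slots_def]
  have M: "chart_diff C (\<lambda>q. raise_index g C \<mu> q $ b) p" "chart_diff C (\<lambda>q. raise_index g C \<mu>' q $ b) p" for b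
    using S1 S2 by (simp_all add: chart_smooth_diff[OF _ p] smooth_raise)
  have d: "chart_diff C \<sigma> p" "chart_diff C \<sigma>' p"
    using S1 S2 by (simp_all add: chart_smooth_diff[OF _ p])
  have "(\<chi> b. nabla_vec g C (raise_index g C \<mu>') a b p) $ b = (- \<rho>' p *\<^sub>R axis a 1) $ b"
    using S2 p z by simp
  then have dM': "pdv C a (\<lambda>q. raise_index g C \<mu>' q $ b) p
    = - \<rho>' p * (if a = b then 1 else 0) - (\<Sum>k\<in>UNIV. christoffel g C a k b p * raise_index g C \<mu>' p $ k)"
    by (cases "a = b") (simp_all add: nabla_vec_def axis_def)
  have "(\<lambda>q. (r *\<^sub>R (\<sigma> q *\<^sub>R raise_index g C \<mu>' q - \<sigma>' q *\<^sub>R raise_index g C \<mu> q)) $ b)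
    = (\<lambda>q. r * (\<sigma> q * raise_index g C \<mu>' q $ b + (-1) * (\<sigma>' q * raise_index g C \<mu> q $ b)))"
    by (simp add: fun_eq_iff)
  then have D: "pdv C a (\<lambda>q. (r *\<^sub>R (\<sigma> q *\<^sub>R raise_index g C \<mu>' q - \<sigma>' q *\<^sub>R raise_index g C \<mu> q)) $ b) p
    = r * (\<sigma> p * pdv C a (\<lambda>q. raise_index g C \<mu>' q $ b) p + \<mu> p $ a * raise_index g C \<mu>' p $ b - \<mu>' p $ a * raise_index g C \<mu> p $ b)"
    using S1 S2 p
    by (simp only: pdv_mult[OF chart p] pdv_add chart_diff_add chart_diff_mult chart_diff_const M d pdv_const)
      (simp add: z)
  \<comment> \<open>The Christoffel symbols of \<open>g'\<close> contracted with \<open>n = \<sigma> \<mu>'\<close>: the factor \<open>\<sigma>\<close> clears the denominator.\<close>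
  have mult_factor: "y * (\<sigma> p * m) = \<sigma> p * (x * m) - w * m" if "y = x - w / \<sigma> p" for x y w m :: real
    unfolding that using nz by (simp add: field_simps)
  have "(\<chi> l. pdv C l \<sigma> p) = \<mu> p"
    using S1 p by (simp add: vec_eq_iff)
  then have \<Gamma>': "christoffel g' C a k b p = christoffel g C a k b p -
    (\<mu> p $ a * (if b = k then 1 else 0) + \<mu> p $ k * (if b = a then 1 else 0) - g C p $ a $ k * raise_index g C \<mu> p $ b) / \<sigma> p" for k
    using christoffel_conformal[of p \<sigma> g' a k b, OF p d(1) nz g'] S1 p by (simp add: raise_index_def)
  have "christoffel g' C a k b p * (\<sigma> p * raise_index g C \<mu>' p $ k) = \<sigma> p * (christoffel g C a k b p * raise_index g C \<mu>' p $ k)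
      - (if k = b then \<mu> p $ a * raise_index g C \<mu>' p $ k else 0) - (if b = a then 1 else 0) * (\<mu> p $ k * raise_index g C \<mu>' p $ k)
      + raise_index g C \<mu> p $ b * (g C p $ a $ k * raise_index g C \<mu>' p $ k)" for k
    unfolding mult_factor[OF \<Gamma>'] by (cases "k = b"; cases "b = a") (auto simp: algebra_simps)
  then have sum_\<Gamma>': "(\<Sum>k\<in>UNIV. christoffel g' C a k b p * (\<sigma> p * raise_index g C \<mu>' p $ k)) =
      \<sigma> p * (\<Sum>k\<in>UNIV. christoffel g C a k b p * raise_index g C \<mu>' p $ k)
      - \<mu> p $ a * raise_index g C \<mu>' p $ b - (if b = a then 1 else 0) * (\<mu> p \<bullet> raise_index g C \<mu>' p)
      + raise_index g C \<mu> p $ b * (g C p *v raise_index g C \<mu>' p) $ a"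
    by (simp only: sum.distrib sum_subtractf sum_distrib_left[symmetric])
      (simp add: inner_vec_def matrix_vector_mult_def)
  have \<Gamma>'_n: "(\<Sum>k\<in>UNIV. christoffel g' C a k b p * (r *\<^sub>R (\<sigma> p *\<^sub>R raise_index g C \<mu>' p - \<sigma>' p *\<^sub>R raise_index g C \<mu> p)) $ k)
    = r * (\<Sum>k\<in>UNIV. christoffel g' C a k b p * (\<sigma> p * raise_index g C \<mu>' p $ k))"
    by (simp add: z sum_distrib_left mult_ac)
  show ?thesis
    unfolding nabla_vec_def D \<Gamma>'_n sum_\<Gamma>' dM' slots_pairing_def g_raise[OF p]
    by (cases "a = b") (simp_all add: z algebra_simps)
qed

end

section \<open>The pairing of parallel tractors on a conformal manifold\<close>

text \<open>Raising the index of a one-form turns its transformation law into that of a vector.  The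
  Jacobian is invertible because \<open>G\<close> is.\<close>

lemma raise_transform:
  fixes J G G' :: "real^'n::finite^'n" and m m' :: "real^'n"
  assumes G: "G = transpose J ** G' ** J" and inv: "invertible G" "invertible G'"
    and m: "m = transpose J *v m'"
  shows "matrix_inv G' *v m' = J *v (matrix_inv G *v m)"
proof -
  have "transpose J ** (G' ** J ** matrix_inv G) = mat 1"
    using invertible_matrix_inv(1)[OF inv(1)] by (simp add: G matrix_mul_assoc)
  then obtain B where B: "B ** transpose J = mat 1"
    using matrix_left_right_inverse by blast
  have cancel: "B *v (transpose J *v x) = x" for x
    by (simp only: matrix_vector_mul_assoc B matrix_vector_mul_lid)
  have "transpose J *v (G' *v (J *v (matrix_inv G *v m))) = G *v (matrix_inv G *v m)"
    by (simp only: G matrix_vector_mul_assoc matrix_mul_assoc)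
  also have "\<dots> = transpose J *v m'"
    unfolding m[symmetric]
    by (simp only: matrix_vector_mul_assoc invertible_matrix_inv[OF inv(1)] matrix_vector_mul_lid)
  finally have "G' *v (J *v (matrix_inv G *v m)) = m'"
    using cancel by metis
  then have "matrix_inv G' *v m' = matrix_inv G' *v (G' *v (J *v (matrix_inv G *v m)))"
    by simp
  then show ?thesis
    by (simp only: matrix_vector_mul_assoc[of "matrix_inv G'" G'] invertible_matrix_inv[OF inv(2)] matrix_vector_mul_lid)
qed

locale conformal_manifold =
  fixes A :: "('m::{t2_space, second_countable_topology}, 'n::finite) chart set"
    and c :: "('m, 'n) metric set"
  assumes atlas: "smooth_atlas A"
    and conf: "conformal_structure A c"
    and conn: "connected (UNIV :: 'm set)"
begin

lemma chart: "C \<in> A \<Longrightarrow> is_chart C"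
  and cover: "(\<Union>C\<in>A. chart_dom C) = UNIV"
  using atlas by (auto simp: smooth_atlas_def)

lemma chart_at: obtains C where "C \<in> A" "p \<in> chart_dom C"
  using cover by blast

lemma metric_riemannian: "g \<in> c \<Longrightarrow> riemannian_metric A UNIV g"
  using conf unfolding conformal_structure_def by blast

text \<open>Statements about all scales are reduced to the change from one fixed scale to another.\<close>

lemma reference_scale: obtains g0 where "g0 \<in> c" "\<And>g. g \<in> c \<Longrightarrow> \<exists>\<omega>. conf_related A \<omega> g0 g"
proof -
  obtain g0 where g0: "riemannian_metric A UNIV g0"
    "c = {g'. riemannian_metric A UNIV g' \<and> (\<exists>\<omega>. conf_related A \<omega> g0 g')}"
    using conf unfolding conformal_structure_def by blast
  have "conf_related A (\<lambda>p. 0) g0 g0"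
    by (simp add: conf_related_def smooth_fun_chart_smooth chart_smooth_const chart)
  then have "g0 \<in> c"
    unfolding g0(2) using g0(1) by blast
  moreover have "\<exists>\<omega>. conf_related A \<omega> g0 g" if "g \<in> c" for g
    using that unfolding g0(2) by blast
  ultimately show thesis by (rule that)
qed

lemma chart_metric:
  assumes "g \<in> c" "C \<in> A"
  shows "chart_metric C g"
proof
  have g: "(\<forall>a b. smooth_on (chart_map C ` (UNIV \<inter> chart_dom C)) (\<lambda>x. g C (chart_inv C x) $ a $ b)) \<and>
    (\<forall>p \<in> UNIV \<inter> chart_dom C. transpose (g C p) = g C p \<and> (\<forall>v. v \<noteq> 0 \<longrightarrow> v \<bullet> (g C p *v v) > 0))"
    using metric_riemannian[OF assms(1)] assms(2) unfolding riemannian_metric_def by blast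
  then show "chart_smooth C (\<lambda>q. g C q $ i $ j)" for i j
    by (simp add: chart_smooth_def)
  show "transpose (g C p) = g C p" if "p \<in> chart_dom C" for p
    using g that by blast
  show "v \<bullet> (g C p *v v) > 0" if "p \<in> chart_dom C" "v \<noteq> 0" for p v
    using g that by blast
qed (rule chart[OF assms(2)])

lemma one_form_raise_transform:
  assumes g: "g \<in> c" and m: "smooth_one_form A UNIV m"
    and C: "C \<in> A" "C' \<in> A" and p: "p \<in> chart_dom C" "p \<in> chart_dom C'"
  shows "ginv g C' p *v m C' p = jacobian C C' p *v (ginv g C p *v m C p)"
  unfolding ginv_def
proof (rule raise_transform)
  show "g C p = transpose (jacobian C C' p) ** g C' p ** jacobian C C' p"
    using metric_riemannian[OF g] C p unfolding riemannian_metric_def by blast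
  show "m C p = transpose (jacobian C C' p) *v m C' p"
    using m C p unfolding smooth_one_form_def by blast
  show "invertible (g C p)" "invertible (g C' p)"
    by (rule positive_definite_invertible, rule chart_metric.pos[OF chart_metric[OF g]]; use C p in simp)+
qed

text \<open>Passing to the chart chosen in the definition multiplies \<open>m\<close> by the transposed Jacobian and the
  raised \<open>n\<close> by the inverse Jacobian, so that the pairing does not change.\<close>

lemma form_pairing_eq:
  assumes g: "g \<in> c" and m: "smooth_one_form A UNIV m" and n: "smooth_one_form A UNIV n"
    and C: "C \<in> A" and p: "p \<in> chart_dom C"
  shows "form_pairing A g m n p = m C p \<bullet> (ginv g C p *v n C p)"
proof -
  define D where "D = (SOME C. C \<in> A \<and> p \<in> chart_dom C)"
  have D: "D \<in> A \<and> p \<in> chart_dom D"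
    unfolding D_def by (rule someI[of _ C]) (use C p in blast)
  have "form_pairing A g m n p = m D p \<bullet> (ginv g D p *v n D p)"
    unfolding form_pairing_def Let_def D_def[symmetric]
    by (simp add: inner_vec_def matrix_vector_mult_def sum_distrib_left mult_ac)
  also have "m D p = transpose (jacobian D C p) *v m C p"
    using m C p D unfolding smooth_one_form_def by blast
  also have "(transpose (jacobian D C p) *v m C p) \<bullet> (ginv g D p *v n D p)
    = m C p \<bullet> (jacobian D C p *v (ginv g D p *v n D p))"
    by (simp add: dot_lmul_matrix)
  also have "jacobian D C p *v (ginv g D p *v n D p) = ginv g C p *v n C p"
    using one_form_raise_transform[OF g n, of D C p] C p D by simp
  finally show ?thesis .
qed

lemma tractor_smooth:
  assumes "is_tractor A c w U" "s \<in> c" "C \<in> A"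
  shows "chart_smooth C (t_sigma (U s) s)" "chart_smooth C (\<lambda>q. t_mu (U s) s C q $ b)"
    "chart_smooth C (t_rho (U s) s)" "smooth_one_form A UNIV (t_mu (U s) s)"
proof -
  have "is_density A c (w + 1) (t_sigma (U s))" "is_weighted_form A c (w + 1) (t_mu (U s))"
    "is_density A c (w - 1) (t_rho (U s))"
    using assms unfolding is_tractor_def by blast+
  then have "smooth_fun A UNIV (t_sigma (U s) s)" "smooth_fun A UNIV (t_rho (U s) s)"
    and \<mu>: "smooth_one_form A UNIV (t_mu (U s) s)"
    using assms(2) unfolding is_density_def is_weighted_form_def by blast+
  then show "chart_smooth C (t_sigma (U s) s)" "chart_smooth C (t_rho (U s) s)"
    "smooth_one_form A UNIV (t_mu (U s) s)"
    using assms(3) by (simp_all add: smooth_fun_chart_smooth)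
  have "\<forall>a. smooth_on (chart_map C ` (UNIV \<inter> chart_dom C)) (\<lambda>x. t_mu (U s) s C (chart_inv C x) $ a)"
    using \<mu> assms(3) unfolding smooth_one_form_def by blast
  then show "chart_smooth C (\<lambda>q. t_mu (U s) s C q $ b)"
    by (simp add: chart_smooth_def)
qed

lemma tractor_metric_in_chart:
  assumes U: "is_tractor A c w U" and V: "is_tractor A c w' V" and s: "s \<in> c"
    and C: "C \<in> A" and p: "p \<in> chart_dom C"
  shows "tractor_metric A U V s p = slots_pairing s C
    (t_sigma (U s) s) (t_mu (U s) s C) (t_rho (U s) s) (t_sigma (V s) s) (t_mu (V s) s C) (t_rho (V s) s) p"
  by (simp add: tractor_metric_def conformal_metric_def slots_pairing_def raise_index_def
      form_pairing_eq[OF s tractor_smooth(4)[OF U s C] tractor_smooth(4)[OF V s C] C p])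

text \<open>Two things change when both the splitting and the scale pass from \<open>g\<close> to \<open>s = E\<^sup>2 g\<close>: the slots are
  mixed by \<open>\<Upsilon> = d\<omega>\<close>, and their values are multiplied by the powers of \<open>E\<close> given by their weights.\<close>

lemma tractor_slots_rescale:
  assumes U: "is_tractor A c 0 U" and g: "g \<in> c" "s \<in> c" and rel: "conf_related A \<omega> g s"
    and C: "C \<in> A" and p: "p \<in> chart_dom C"
  defines "E \<equiv> exp (\<omega> p)" and "\<Upsilon> \<equiv> (\<chi> b. pdv C b \<omega> p)"
    and "\<sigma> \<equiv> t_sigma (U g) g p" and "\<mu> \<equiv> t_mu (U g) g C p" and "\<rho> \<equiv> t_rho (U g) g p"
  shows "ginv s C p = (1 / E\<^sup>2) *\<^sub>R ginv g C p"
    and "t_sigma (U s) s p = E * \<sigma>"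
    and "t_mu (U s) s C p = E *\<^sub>R (\<mu> + \<sigma> *\<^sub>R \<Upsilon>)"
    and "t_rho (U s) s p = (\<rho> - \<Upsilon> \<bullet> (ginv g C p *v \<mu>) - (1/2) * \<sigma> * (\<Upsilon> \<bullet> (ginv g C p *v \<Upsilon>))) / E"
proof -
  interpret chart_metric C g by (rule chart_metric[OF g(1) C])
  have E: "E \<noteq> 0" by (simp add: E_def)
  have "s C p = E\<^sup>2 *\<^sub>R g C p"
    using rel C p by (simp add: conf_related_def E_def exp_double)
  then show gs: "ginv s C p = (1 / E\<^sup>2) *\<^sub>R ginv g C p"
    unfolding ginv_def[of s]
    by (intro matrix_inv_eqI) (use E g_inverse[OF p] in \<open>simp add: matrix_scalar_ac flip: scalar_matrix_assoc\<close>)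
  have "is_density A c (0 + 1) (t_sigma (U g))" "is_weighted_form A c (0 + 1) (t_mu (U g))"
    "is_density A c (0 - 1) (t_rho (U g))"
    using U g(1) unfolding is_tractor_def by blast+
  then have "t_sigma (U g) s p = exp ((0 + 1) * \<omega> p) * \<sigma>" "t_mu (U g) s C p = exp ((0 + 1) * \<omega> p) *\<^sub>R \<mu>"
    "t_rho (U g) s p = exp ((0 - 1) * \<omega> p) * \<rho>"
    unfolding is_density_def is_weighted_form_def \<sigma>_def \<mu>_def \<rho>_def using g rel C p by blast+
  then have weights: "t_sigma (U g) s p = E * \<sigma>" "t_mu (U g) s C p = E *\<^sub>R \<mu>" "t_rho (U g) s p = \<rho> / E"
    by (simp_all add: E_def exp_minus divide_inverse mult.commute)
  have "tractor_transf A c \<omega> (U g) (U s)"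
    using U g rel unfolding is_tractor_def by blast
  from bspec[OF bspec[OF bspec[OF this[unfolded tractor_transf_def Let_def] g(2)] C] p]
  have transf: "t_sigma (U s) s p = E * \<sigma>"
    "\<And>b. t_mu (U s) s C p $ b = (E *\<^sub>R \<mu>) $ b + E * \<sigma> * \<Upsilon> $ b"
    "t_rho (U s) s p = \<rho> / E - (\<Sum>b\<in>UNIV. \<Sum>k\<in>UNIV. ginv s C p $ b $ k * \<Upsilon> $ b * (E *\<^sub>R \<mu>) $ k)
       - (1/2) * (E * \<sigma>) * (\<Sum>b\<in>UNIV. \<Sum>k\<in>UNIV. ginv s C p $ b $ k * \<Upsilon> $ b * \<Upsilon> $ k)"
    by (simp_all add: weights conformal_metric_def \<Upsilon>_def)
  show "t_sigma (U s) s p = E * \<sigma>" by (rule transf)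
  show "t_mu (U s) s C p = E *\<^sub>R (\<mu> + \<sigma> *\<^sub>R \<Upsilon>)"
    by (simp add: vec_eq_iff transf algebra_simps)
  have sum_inner: "(\<Sum>b\<in>UNIV. \<Sum>k\<in>UNIV. B $ b $ k * u $ b * v $ k) = u \<bullet> (B *v v)"
    for B :: "real^'n^'n" and u v :: "real^'n"
    by (simp add: inner_vec_def matrix_vector_mult_def sum_distrib_left mult_ac)
  have scale: "((1 / E\<^sup>2) *\<^sub>R ginv g C p) *v v = (1 / E\<^sup>2) *\<^sub>R (ginv g C p *v v)" for v
    by (simp add: scaleR_matrix_vector_assoc)
  show "t_rho (U s) s p = (\<rho> - \<Upsilon> \<bullet> (ginv g C p *v \<mu>) - (1/2) * \<sigma> * (\<Upsilon> \<bullet> (ginv g C p *v \<Upsilon>))) / E"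
    unfolding transf(3) sum_inner gs scale
    using E by (simp add: matrix_vector_mult_scaleR field_simps power2_eq_square)
qed

text \<open>The definition evaluates \<open>h(U, V)\<close> in a different splitting for each scale.  The powers of \<open>E\<close>
  cancel since \<open>h\<close> has weight 0, and so do the terms with \<open>\<Upsilon>\<close>, by the choice of the
  transformation law of tractors.\<close>

lemma tractor_metric_conformally_invariant:
  assumes U: "is_tractor A c 0 U" and V: "is_tractor A c 0 V" and g: "g \<in> c" "s \<in> c"
    and rel: "conf_related A \<omega> g s"
  shows "tractor_metric A U V s p = tractor_metric A U V g p"
proof -
  obtain C where C: "C \<in> A" "p \<in> chart_dom C" by (rule chart_at)
  interpret chart_metric C g by (rule chart_metric[OF g(1) C(1)])
  note rescale = tractor_slots_rescale[OF _ g rel C]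
  define B where "B = ginv g C p"
  have E: "exp (\<omega> p) \<noteq> 0" by simp
  have B_sym: "u \<bullet> (B *v v) = v \<bullet> (B *v u)" for u v
  proof -
    have "transpose B = B"
      by (simp add: B_def transpose_def vec_eq_iff ginv_sym[OF C(2)])
    then show ?thesis
      using dot_lmul_matrix[of u B v] by (metis inner_commute transpose_matrix_vector)
  qed
  show ?thesis
    unfolding tractor_metric_in_chart[OF U V g(2) C] tractor_metric_in_chart[OF U V g(1) C]
      slots_pairing_def raise_index_def rescale[OF U] rescale[OF V] B_def[symmetric]
    using E by (simp add: scaleR_matrix_vector_assoc[symmetric] matrix_vector_mult_scaleR
        matrix_vector_right_distrib inner_add_left inner_add_right B_sym[of "t_mu (U g) g C p" "\<chi> b. pdv C b \<omega> p"]
        field_simps power2_eq_square)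
qed

end

context conformal_manifold
begin

lemma parallel_tractor_slots:
  assumes K: "parallel_tractor A c K" and g: "g \<in> c" and C: "C \<in> A"
  shows "parallel_slots g C (schouten g C) (t_sigma (K g) g) (t_mu (K g) g C) (t_rho (K g) g)"
proof -
  interpret chart_metric C g by (rule chart_metric[OF g C])
  have T: "is_tractor A c 0 K"
    and conn: "\<And>p a. p \<in> chart_dom C \<Longrightarrow> tractor_conn g C K a p = 0"
    using K g C unfolding parallel_tractor_def by blast+
  let ?\<sigma> = "t_sigma (K g) g" and ?\<mu> = "t_mu (K g) g C" and ?\<rho> = "t_rho (K g) g"
  have raise: "(\<lambda>q. ginv g C q *v ?\<mu> q) = raise_index g C ?\<mu>"
    by (simp add: fun_eq_iff raise_index_def)
  show ?thesis
    unfolding parallel_slots_def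
  proof (intro conjI ballI allI tractor_smooth[OF T g C])
    fix p a assume p: "p \<in> chart_dom C"
    note eqs = conn[OF p, of a, unfolded tractor_conn_def Let_def zero_prod_def prod.inject raise]
    from eqs show "pdv C a ?\<sigma> p = ?\<mu> p $ a" by simp
    from eqs show "pdv C a ?\<rho> p = schouten g C p $ a \<bullet> raise_index g C ?\<mu> p"
      by (simp add: inner_vec_def raise_index_def)
    show "(\<chi> b. nabla_vec g C (raise_index g C ?\<mu>) a b p) =
      - ?\<rho> p *\<^sub>R axis a 1 - ?\<sigma> p *\<^sub>R (ginv g C p *v schouten g C p $ a)"
    proof (simp only: vec_eq_iff, intro allI)
      fix b
      have "nabla_vec g C (raise_index g C ?\<mu>) a b p + (if a = b then ?\<rho> p else 0)
        + (\<Sum>k\<in>UNIV. schouten g C p $ a $ k * ginv g C p $ k $ b) * ?\<sigma> p = 0"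
        using eqs by (simp add: vec_eq_iff)
      moreover have "(\<Sum>k\<in>UNIV. schouten g C p $ a $ k * ginv g C p $ k $ b) = (ginv g C p *v schouten g C p $ a) $ b"
        unfolding matrix_vector_mult_def by (simp add: ginv_sym[OF p, of b] mult.commute)
      ultimately show "(\<chi> b. nabla_vec g C (raise_index g C ?\<mu>) a b p) $ b =
        (- ?\<rho> p *\<^sub>R axis a 1 - ?\<sigma> p *\<^sub>R (ginv g C p *v schouten g C p $ a)) $ b"
        by (cases "a = b") (simp_all add: axis_def algebra_simps)
    qed
  qed
qed

lemma tractor_metric_parallel_constant:
  assumes K: "parallel_tractor A c K" and L: "parallel_tractor A c L" and g: "g \<in> c"
  shows "tractor_metric A K L g p = tractor_metric A K L g q"
proof (rule constant_if_pdv_eq_0[OF chart cover conn])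
  fix C p a assume C: "C \<in> A" and p: "p \<in> chart_dom C"
  have T: "is_tractor A c 0 K" "is_tractor A c 0 L"
    using K L by (simp_all add: parallel_tractor_def)
  note const = chart_metric.slots_pairing_constant[OF chart_metric[OF g C]
      parallel_tractor_slots[OF K g C] parallel_tractor_slots[OF L g C] p]
  note eq = tractor_metric_in_chart[OF T g C]
  show "chart_diff C (tractor_metric A K L g) p"
    using const(1) chart_diff_cong[OF chart[OF C] p eq] by simp
  show "pdv C a (tractor_metric A K L g) p = 0"
    using const(2) pdv_cong[OF chart[OF C] p eq] by simp
qed

lemma tractor_metric_parallel_scale_independent:
  assumes K: "parallel_tractor A c K" and L: "parallel_tractor A c L" and s: "s \<in> c" "s' \<in> c"
  shows "tractor_metric A K L s p = tractor_metric A K L s' q"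
proof -
  obtain g0 where g0: "g0 \<in> c" "\<And>g. g \<in> c \<Longrightarrow> \<exists>\<omega>. conf_related A \<omega> g0 g"
    by (rule reference_scale) blast
  have T: "is_tractor A c 0 K" "is_tractor A c 0 L"
    using K L by (simp_all add: parallel_tractor_def)
  have inv: "tractor_metric A K L g r = tractor_metric A K L g0 r" if g: "g \<in> c" for g r
  proof -
    obtain \<omega> where "conf_related A \<omega> g0 g" using g0(2)[OF g] by blast
    then show ?thesis by (rule tractor_metric_conformally_invariant[OF T g0(1) g])
  qed
  have "tractor_metric A K L s p = tractor_metric A K L g0 p"
    by (rule inv[OF s(1)])
  also have "\<dots> = tractor_metric A K L g0 q"
    by (rule tractor_metric_parallel_constant[OF K L g0(1)])
  also have "\<dots> = tractor_metric A K L s' q"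
    by (rule inv[OF s(2), symmetric])
  finally show ?thesis .
qed

text \<open>\<open>S_const\<close> is a definite description of a number common to all scales and points.  Together, local
  constancy, connectedness and conformal invariance show that this number exists.\<close>

lemma S_const_eq:
  assumes K: "parallel_tractor A c K" and s: "s \<in> c"
  shows "S_const A c K = - tractor_metric A K K s p"
  unfolding S_const_def
proof (rule the_equality)
  show "\<forall>s'\<in>c. \<forall>q. - tractor_metric A K K s' q = - tractor_metric A K K s p"
    by (intro ballI allI arg_cong[where f = uminus] tractor_metric_parallel_scale_independent[OF K K _ s])
  show "r = - tractor_metric A K K s p" if "\<forall>s'\<in>c. \<forall>q. - tractor_metric A K K s' q = r" for r
  proof -
    have "- tractor_metric A K K s p = r" using that s by blast
    then show ?thesis by (rule sym)
  qed
qed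

lemma singularity_set_eq:
  assumes K: "is_tractor A c 0 K" and s: "s \<in> c"
  shows "singularity_set A c K = {p. t_sigma (K s) s p = 0}"
proof -
  obtain g0 where g0: "g0 \<in> c" "\<And>g. g \<in> c \<Longrightarrow> \<exists>\<omega>. conf_related A \<omega> g0 g"
    by (rule reference_scale) blast
  have zero_iff: "t_sigma (K g) g p = 0 \<longleftrightarrow> t_sigma (K g0) g0 p = 0" if g: "g \<in> c" for g p
  proof -
    obtain C where C: "C \<in> A" "p \<in> chart_dom C" by (rule chart_at)
    obtain \<omega> where "conf_related A \<omega> g0 g" using g0(2)[OF g] by blast
    from tractor_slots_rescale(2)[OF K g0(1) g this C] show ?thesis by simp
  qed
  have "(\<forall>g\<in>c. t_sigma (K g) g p = 0) \<longleftrightarrow> t_sigma (K s) s p = 0" for p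
    using s zero_iff[of s p] zero_iff[of _ p] by blast
  then show ?thesis
    by (simp add: singularity_set_def scale_of_def tractor_metric_canonical)
qed

end

section \<open>The zero set of one scale in the Einstein metric of another\<close>

locale tractor_pair = conformal_manifold A c
  for A :: "('m::{t2_space, second_countable_topology}, 'n::finite) chart set"
    and c :: "('m, 'n) metric set" +
  fixes K1 K2 :: "('m, 'n) tractor"
  assumes K1: "parallel_tractor A c K1" and K2: "parallel_tractor A c K2"
    and neg: "S_const A c K2 < 0"
begin

text \<open>The computations use the scale in which \<open>tractor_scale_metric\<close> evaluates \<open>\<sigma>\<^sup>-\<^sup>2 \<^bold>g\<close>.\<close>

definition g0 :: "('m, 'n) metric" where "g0 = (SOME s. s \<in> c)"

abbreviation "\<sigma>1 \<equiv> t_sigma (K1 g0) g0"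
abbreviation "\<sigma>2 \<equiv> t_sigma (K2 g0) g0"
abbreviation "\<mu>1 \<equiv> t_mu (K1 g0) g0"
abbreviation "\<mu>2 \<equiv> t_mu (K2 g0) g0"

abbreviation "g\<^sub>o \<equiv> tractor_scale_metric A c K1"
abbreviation "\<Sigma> \<equiv> singularity_set A c K2 - singularity_set A c K1"

text \<open>\<open>N\<close> is the gradient, with respect to \<open>g\<^sub>o\<close>, of \<open>\<sigma>2 / \<sigma>1\<close>, divided by its length along \<open>\<Sigma>\<close>.  In this
  polynomial form it is smooth on the whole manifold, across the zeros of \<open>\<sigma>1\<close>.  The sign of \<open>N\<close>
  relative to \<open>\<mu>2\<close> changes with that of \<open>\<sigma>1\<close>, which makes the mean curvature the same constant on all
  components of \<open>\<Sigma>\<close>.\<close>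

definition N :: "('m, 'n) vec_comps" where
  "N C q = (1 / sqrt (- S_const A c K2)) *\<^sub>R
     (\<sigma>1 q *\<^sub>R raise_index g0 C (\<mu>2 C) q - \<sigma>2 q *\<^sub>R raise_index g0 C (\<mu>1 C) q)"

text \<open>Since \<open>h(K1, K2)\<close> is constant it may be evaluated at any point.\<close>

definition H :: real where
  "H = - tractor_metric A K1 K2 g0 undefined / sqrt (- S_const A c K2)"

lemma g0_in: "g0 \<in> c"
proof -
  obtain g where "g \<in> c" by (rule reference_scale)
  then show ?thesis unfolding g0_def by (rule someI[where P = "\<lambda>s. s \<in> c"])
qed

lemma is_tractors: "is_tractor A c 0 K1" "is_tractor A c 0 K2"
  using K1 K2 by (simp_all add: parallel_tractor_def)

lemma in_\<Sigma>: "p \<in> \<Sigma> \<longleftrightarrow> \<sigma>2 p = 0 \<and> \<sigma>1 p \<noteq> 0"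
  by (simp add: singularity_set_eq[OF is_tractors(1) g0_in] singularity_set_eq[OF is_tractors(2) g0_in])

lemma g\<^sub>o_eq: "g\<^sub>o C p = (1 / (\<sigma>1 p)\<^sup>2) *\<^sub>R g0 C p"
  by (simp add: tractor_scale_metric_def g0_def[symmetric] Let_def conformal_metric_def scale_of_def
      tractor_metric_canonical)

lemma g\<^sub>o_vec: "g\<^sub>o C p *v v = (1 / (\<sigma>1 p)\<^sup>2) *\<^sub>R (g0 C p *v v)"
  by (simp add: g\<^sub>o_eq scaleR_matrix_vector_assoc)

lemma metric_g0: "C \<in> A \<Longrightarrow> chart_metric C g0"
  by (rule chart_metric[OF g0_in])

lemma N_on_\<Sigma>:
  assumes "p \<in> \<Sigma>"
  shows "N C p = (\<sigma>1 p / sqrt (- S_const A c K2)) *\<^sub>R raise_index g0 C (\<mu>2 C) p"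
  using assms unfolding in_\<Sigma> by (simp add: N_def)

text \<open>Where \<open>\<sigma>2 = 0\<close>, only the middle slot contributes to \<open>h(K2, K2)\<close>.  So \<open>d\<sigma>2 = \<mu>2\<close> has constant
  length along \<open>\<Sigma>\<close>, and \<open>h(K2, K2) > 0\<close> makes \<open>\<Sigma>\<close> a regular level set.\<close>

lemma gradient_length:
  assumes p: "p \<in> \<Sigma>" and C: "C \<in> A" "p \<in> chart_dom C"
  shows "\<mu>2 C p \<bullet> raise_index g0 C (\<mu>2 C) p = - S_const A c K2"
  using p tractor_metric_in_chart[OF is_tractors(2,2) g0_in C] S_const_eq[OF K2 g0_in, of p]
  unfolding in_\<Sigma> by (simp add: slots_pairing_def)

lemma gradient_nonzero:
  assumes "p \<in> \<Sigma>" "C \<in> A" "p \<in> chart_dom C"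
  shows "\<mu>2 C p \<noteq> 0"
  using gradient_length[OF assms] neg by auto

lemma tangent_orthogonal_gradient:
  assumes p: "p \<in> \<Sigma>" and C: "C \<in> A" "p \<in> chart_dom C" and v: "v \<in> tangent_to \<Sigma> C p"
  shows "v \<bullet> \<mu>2 C p = 0"
proof -
  obtain \<gamma> \<epsilon> where \<gamma>: "\<gamma> 0 = p" "\<epsilon> > 0" "\<And>t. \<bar>t\<bar> < \<epsilon> \<Longrightarrow> \<gamma> t \<in> \<Sigma> \<inter> chart_dom C"
    "((\<lambda>t. chart_map C (\<gamma> t)) has_vector_derivative v) (at 0)"
    using v unfolding tangent_to_def by blast
  have "chart_diff C \<sigma>2 p"
    by (rule chart_smooth_diff[OF tractor_smooth(1)[OF is_tractors(2) g0_in C(1)] C(2)])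
  then have "((\<lambda>t. \<sigma>2 (\<gamma> t)) has_vector_derivative (\<Sum>a\<in>UNIV. v $ a * pdv C a \<sigma>2 p)) (at 0)"
    using chart_diff_along_curve[OF chart[OF C(1)], of \<sigma>2 \<gamma> \<epsilon> v] \<gamma> by simp
  moreover have "((\<lambda>t. \<sigma>2 (\<gamma> t)) has_vector_derivative 0) (at 0)"
  proof (rule has_vector_derivative_transform_within_open[of "\<lambda>t. 0" _ _ "{-\<epsilon><..<\<epsilon>}"])
    show "0 = \<sigma>2 (\<gamma> t)" if "t \<in> {-\<epsilon><..<\<epsilon>}" for t
    proof -
      have "\<bar>t\<bar> < \<epsilon>" using that by auto
      then have "\<gamma> t \<in> \<Sigma>" using \<gamma>(3) by blast
      then show ?thesis using in_\<Sigma>[of "\<gamma> t"] by presburger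
    qed
  qed (use \<gamma>(2) in auto)
  ultimately have "(\<Sum>a\<in>UNIV. v $ a * pdv C a \<sigma>2 p) = 0"
    by (rule vector_derivative_unique_at)
  moreover have "pdv C a \<sigma>2 p = \<mu>2 C p $ a" for a
    using parallel_tractor_slots[OF K2 g0_in C(1)] C(2) unfolding parallel_slots_def by blast
  ultimately show ?thesis
    by (simp add: inner_vec_def)
qed

lemma N_smooth: "smooth_vector_field A UNIV N"
  unfolding smooth_vector_field_def
proof (intro conjI ballI allI)
  fix C :: "('m, 'n) chart" and a assume C: "C \<in> A"
  note ch = chart[OF C]
  note sm = tractor_smooth[OF is_tractors(1) g0_in C] tractor_smooth[OF is_tractors(2) g0_in C]
  have "chart_smooth C (\<lambda>q. (1 / sqrt (- S_const A c K2)) *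
      (\<sigma>1 q * raise_index g0 C (\<mu>2 C) q $ a + (-1) * (\<sigma>2 q * raise_index g0 C (\<mu>1 C) q $ a)))"
    by (intro chart_smooth_add chart_smooth_mult chart_smooth_const ch sm(1,5)
        chart_metric.smooth_raise[OF metric_g0[OF C]] sm(2,6))
  moreover have "(\<lambda>q. N C q $ a) = (\<lambda>q. (1 / sqrt (- S_const A c K2)) *
      (\<sigma>1 q * raise_index g0 C (\<mu>2 C) q $ a + (-1) * (\<sigma>2 q * raise_index g0 C (\<mu>1 C) q $ a)))"
    by (simp add: N_def fun_eq_iff)
  ultimately have "chart_smooth C (\<lambda>q. N C q $ a)" by simp
  then show "smooth_on (chart_map C ` (UNIV \<inter> chart_dom C)) (\<lambda>x. N C (chart_inv C x) $ a)"
    by (simp add: chart_smooth_def)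
next
  fix C C' :: "('m, 'n) chart" and p assume C: "C \<in> A" "C' \<in> A" "p \<in> UNIV \<inter> chart_dom C \<inter> chart_dom C'"
  note raise =
    one_form_raise_transform[OF g0_in tractor_smooth(4)[OF is_tractors(1) g0_in C(1)] C(1,2), of p]
    one_form_raise_transform[OF g0_in tractor_smooth(4)[OF is_tractors(2) g0_in C(1)] C(1,2), of p]
  show "N C' p = jacobian C C' p *v N C p"
    using C(3) by (simp add: N_def raise_index_def raise
        matrix_vector_mult_scaleR matrix_vector_mult_diff_distrib)
qed

lemma g0_N:
  assumes p: "p \<in> \<Sigma>" and C: "C \<in> A" "p \<in> chart_dom C"
  shows "g0 C p *v N C p = (\<sigma>1 p / sqrt (- S_const A c K2)) *\<^sub>R \<mu>2 C p"
  by (simp add: N_on_\<Sigma>[OF p] matrix_vector_mult_scaleR chart_metric.g_raise[OF metric_g0[OF C(1)] C(2)])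

lemma N_unit:
  assumes p: "p \<in> \<Sigma>" and C: "C \<in> A" "p \<in> chart_dom C"
  shows "N C p \<bullet> (g\<^sub>o C p *v N C p) = 1"
proof -
  have nz: "\<sigma>1 p \<noteq> 0" using p in_\<Sigma> by blast
  have "N C p \<bullet> (g\<^sub>o C p *v N C p)
    = (1 / (\<sigma>1 p)\<^sup>2) * ((\<sigma>1 p / sqrt (- S_const A c K2)) * (N C p \<bullet> \<mu>2 C p))"
    by (simp add: g\<^sub>o_vec g0_N[OF assms])
  also have "N C p \<bullet> \<mu>2 C p = \<sigma>1 p / sqrt (- S_const A c K2) * - S_const A c K2"
    using gradient_length[OF assms] by (simp add: N_on_\<Sigma>[OF p] inner_commute)
  also have "- S_const A c K2 = sqrt (- S_const A c K2) * sqrt (- S_const A c K2)"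
    using neg by simp
  finally show ?thesis
    using neg nz by (simp add: power2_eq_square)
qed

lemma N_unit_normal: "unit_normal_field A g\<^sub>o \<Sigma> UNIV N"
  unfolding unit_normal_field_def
proof (intro conjI ballI open_UNIV N_smooth)
  fix C p assume C: "C \<in> A" and "p \<in> \<Sigma> \<inter> UNIV \<inter> chart_dom C"
  then have p: "p \<in> \<Sigma>" "p \<in> chart_dom C" by blast+
  show "N C p \<bullet> (g\<^sub>o C p *v N C p) = 1"
    by (rule N_unit[OF p(1) C p(2)])
  show "N C p \<bullet> (g\<^sub>o C p *v v) = 0" if v: "v \<in> tangent_to \<Sigma> C p" for v
    using tangent_orthogonal_gradient[OF p(1) C p(2) v]
      chart_metric.g_inner_sym[OF metric_g0[OF C] p(2), of "N C p" v]
    by (simp add: g\<^sub>o_vec g0_N[OF p(1) C p(2)])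
qed

text \<open>The shape operator is the multiple \<open>H\<close> of the identity.  This gives both umbilicity and the value
  of the mean curvature.\<close>

lemma nabla_N:
  assumes p: "p \<in> \<Sigma>" and C: "C \<in> A" "p \<in> chart_dom C"
  shows "nabla_vec g\<^sub>o C (N C) a b p = H * (if a = b then 1 else 0)"
proof -
  have "N C = (\<lambda>q. (1 / sqrt (- S_const A c K2)) *\<^sub>R
     (\<sigma>1 q *\<^sub>R raise_index g0 C (\<mu>2 C) q - \<sigma>2 q *\<^sub>R raise_index g0 C (\<mu>1 C) q))"
    by (simp add: N_def fun_eq_iff)
  moreover have nz: "\<sigma>1 p \<noteq> 0" and z: "\<sigma>2 p = 0" using p in_\<Sigma> by blast+
  ultimately have "nabla_vec g\<^sub>o C (N C) a b p
    = - (1 / sqrt (- S_const A c K2)) * tractor_metric A K1 K2 g0 p * (if a = b then 1 else 0)"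
    using chart_metric.nabla_normal[where g' = "g\<^sub>o", OF metric_g0[OF C(1)]
        parallel_tractor_slots[OF K1 g0_in C(1)] parallel_tractor_slots[OF K2 g0_in C(1)] C(2) nz z g\<^sub>o_eq]
    by (simp only: tractor_metric_in_chart[OF is_tractors g0_in C])
  also have "tractor_metric A K1 K2 g0 p = tractor_metric A K1 K2 g0 undefined"
    by (rule tractor_metric_parallel_constant[OF K1 K2 g0_in])
  finally show ?thesis
    by (simp add: H_def)
qed

lemma second_fundamental_form_N:
  assumes "p \<in> \<Sigma>" "C \<in> A" "p \<in> chart_dom C"
  shows "second_fundamental_form g\<^sub>o N C p u v = H * (u \<bullet> (g\<^sub>o C p *v v))"
proof -
  have "(\<chi> b. \<Sum>a\<in>UNIV. u $ a * nabla_vec g\<^sub>o C (N C) a b p) = H *\<^sub>R u"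
    by (simp add: vec_eq_iff nabla_N[OF assms] if_distrib cong: if_cong)
  then show ?thesis
    by (simp add: second_fundamental_form_def)
qed

text \<open>The form \<open>H g\<^sub>o\<close> has the trace \<open>H (d - 1)\<close> over the tangent space, because \<open>N\<close> has unit length.\<close>

lemma mean_curvature_N:
  assumes p: "p \<in> \<Sigma>" and C: "C \<in> A" "p \<in> chart_dom C" and dim: "CARD('n) \<ge> 2"
  shows "mean_curvature g\<^sub>o N C p = H"
proof -
  have nz: "\<sigma>1 p \<noteq> 0" using p in_\<Sigma> by blast
  interpret chart_metric C g0 by (rule metric_g0[OF C(1)])
  have trace: "metric_trace g\<^sub>o C p (g\<^sub>o C p) = real CARD('n)"
  proof (rule metric_trace_metric)
    show "transpose (g\<^sub>o C p) = g\<^sub>o C p"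
      by (simp add: g\<^sub>o_eq transpose_scalar sym[OF C(2)])
    show "v \<bullet> (g\<^sub>o C p *v v) > 0" if "v \<noteq> 0" for v
      using pos[OF C(2) that] nz by (simp add: g\<^sub>o_vec)
  qed
  have "axis a 1 \<bullet> (g\<^sub>o C p *v axis b 1) = g\<^sub>o C p $ a $ b" for a b
    by (simp add: inner_axis' matrix_vector_mul_component inner_axis)
  then have "(\<Sum>a\<in>UNIV. \<Sum>b\<in>UNIV. (ginv g\<^sub>o C p $ a $ b - N C p $ a * N C p $ b) *
      second_fundamental_form g\<^sub>o N C p (axis a 1) (axis b 1))
    = H * (metric_trace g\<^sub>o C p (g\<^sub>o C p) - (\<Sum>a\<in>UNIV. \<Sum>b\<in>UNIV. N C p $ a * (g\<^sub>o C p $ a $ b * N C p $ b)))"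
    by (simp add: second_fundamental_form_N[OF p C] metric_trace_def sum_distrib_left sum_subtractf algebra_simps)
  also have "(\<Sum>a\<in>UNIV. \<Sum>b\<in>UNIV. N C p $ a * (g\<^sub>o C p $ a $ b * N C p $ b)) = N C p \<bullet> (g\<^sub>o C p *v N C p)"
    by (simp add: inner_vec_def matrix_vector_mult_def sum_distrib_left)
  finally show ?thesis
    using dim by (simp add: mean_curvature_def trace N_unit[OF p C] field_simps)
qed

lemma embedded: "embedded_hypersurface A \<Sigma>"
  unfolding embedded_hypersurface_def
proof
  fix p assume p: "p \<in> \<Sigma>"
  let ?U = "{q. \<sigma>1 q \<noteq> 0}"
  have "continuous_on UNIV \<sigma>1"
    by (rule continuous_on_atlas[OF chart cover tractor_smooth(1)[OF is_tractors(1) g0_in]])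
  then have "open ?U"
    by (rule open_Collect_neq) simp
  moreover have "p \<in> ?U" using p in_\<Sigma> by blast
  moreover have "smooth_fun A ?U \<sigma>2"
    unfolding smooth_fun_def
  proof
    fix C assume "C \<in> A"
    from tractor_smooth(1)[OF is_tractors(2) g0_in this]
    have "smooth_on (chart_map C ` chart_dom C) (\<lambda>x. \<sigma>2 (chart_inv C x))"
      by (simp add: chart_smooth_def)
    then show "smooth_on (chart_map C ` (?U \<inter> chart_dom C)) (\<lambda>x. \<sigma>2 (chart_inv C x))"
      by (rule smooth_on_subset) blast
  qed
  moreover have "\<Sigma> \<inter> ?U = {q \<in> ?U. \<sigma>2 q = 0}"
    using in_\<Sigma> by blast
  moreover have "\<exists>a. pdv C a \<sigma>2 p \<noteq> 0" if C: "C \<in> A" "p \<in> chart_dom C" for C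
  proof -
    have "\<exists>a. \<mu>2 C p $ a \<noteq> 0"
      using gradient_nonzero[OF p C] by (simp add: vec_eq_iff)
    moreover have "pdv C a \<sigma>2 p = \<mu>2 C p $ a" for a
      using parallel_tractor_slots[OF K2 g0_in C(1)] C(2) unfolding parallel_slots_def by blast
    ultimately show ?thesis by simp
  qed
  ultimately show "\<exists>U f. open U \<and> p \<in> U \<and> smooth_fun A U f \<and> \<Sigma> \<inter> U = {q\<in>U. f q = 0} \<and>
      (\<forall>C\<in>A. p \<in> chart_dom C \<longrightarrow> (\<exists>a. pdv C a f p \<noteq> 0))"
    by (intro exI[of _ ?U] exI[of _ \<sigma>2] conjI ballI impI)
qed

lemma umbilic: "totally_umbilic A g\<^sub>o \<Sigma>"
  unfolding totally_umbilic_def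
  by (intro ballI exI[of _ UNIV] exI[of _ N] exI[of _ H] conjI impI UNIV_I N_unit_normal
      second_fundamental_form_N)

lemma cmc: "CARD('n) \<ge> 2 \<Longrightarrow> constant_mean_curvature A g\<^sub>o \<Sigma>"
  unfolding constant_mean_curvature_def
  by (intro exI[of _ UNIV] exI[of _ N] exI[of _ H] conjI ballI subset_UNIV N_unit_normal)
    (simp add: mean_curvature_N)

lemma minimal_and_geodesic_if_orthogonal:
  assumes dim: "CARD('n) \<ge> 2" and "\<forall>s\<in>c. \<forall>p. tractor_metric A K1 K2 s p = 0"
  shows "minimal_hypersurface A g\<^sub>o \<Sigma>" "totally_geodesic A g\<^sub>o \<Sigma>"
proof -
  have H: "H = 0" using assms(2) g0_in by (simp add: H_def)
  show "minimal_hypersurface A g\<^sub>o \<Sigma>"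
    unfolding minimal_hypersurface_def
    by (intro ballI exI[of _ UNIV] exI[of _ N] conjI impI UNIV_I N_unit_normal)
      (simp add: mean_curvature_N[OF _ _ _ dim] H)
  show "totally_geodesic A g\<^sub>o \<Sigma>"
    unfolding totally_geodesic_def
    by (intro ballI exI[of _ UNIV] exI[of _ N] conjI impI UNIV_I N_unit_normal)
      (simp add: second_fundamental_form_N H)
qed

end

theorem theorem1p3:
  fixes A :: "('m::{t2_space, second_countable_topology}, 'n::finite) chart set"
    and c :: "('m, 'n) metric set"
    and K1 K2 :: "('m, 'n) tractor"
  assumes dim: "CARD('n) \<ge> 3"
    and manifold: "smooth_atlas A"
    and conn: "connected (UNIV :: 'm set)"
    and conf: "conformal_structure A c"
    and K1: "parallel_tractor A c K1"
    and K2: "parallel_tractor A c K2"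
    and indep: "tractors_independent A c K1 K2"
    and neg: "S_const A c K2 < 0"
    and sing: "singularity_set A c K2 \<noteq> {}"
  defines "g\<^sub>o \<equiv> tractor_scale_metric A c K1"
    and "\<Sigma> \<equiv> singularity_set A c K2 - singularity_set A c K1"
  shows "embedded_hypersurface A \<Sigma> \<and> totally_umbilic A g\<^sub>o \<Sigma> \<and> constant_mean_curvature A g\<^sub>o \<Sigma> \<and>
    ((\<forall>s\<in>c. \<forall>p. tractor_metric A K1 K2 s p = 0) \<longrightarrow>
       minimal_hypersurface A g\<^sub>o \<Sigma> \<and> totally_geodesic A g\<^sub>o \<Sigma>)"
proof -
  interpret pair: tractor_pair A c K1 K2
    by unfold_locales (fact manifold conf conn K1 K2 neg)+
  have "CARD('n) \<ge> 2" using dim by simp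
  then show ?thesis
    unfolding g\<^sub>o_def \<Sigma>_def
    using pair.embedded pair.umbilic pair.cmc pair.minimal_and_geodesic_if_orthogonal by blast
qed

end
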